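(* Assume that $r=p^{\varrho(p)}$, where $p$ is a rational prime with $p\bmod12=1$ and $\varrho(p)>2$ is an integer. Then the whole set of solution cosets of the norm equation $N(\alpha)=r$ has cardinality $$\sharp(r)=\frac{(\varrho(p)+2)\left(2\varrho(p)^2+8\varrho(p)+15+9(-1)^{\varrho(p)}\right)}{48}$$ and is partitioned into $\flat(r)=[\varrho(p)/2]+1$ families, where one family is of Class B1 and the remaining families are of Class B2.
   Context: $\zeta=(\sqrt{3}+\sqrt{-1})/2$ is a primitive 12-th root of unity; $N$ is the norm on $\mathbb{Z}[\zeta]$ (product of 4 Galois conjugates); $[x]$ is the integer part. The (possibly degenerate) $\mathbb{Z}^2$-triangle with vertices $(0,0),(m,n),(k,l)$ is identified with $\{m,n,k,l\}:=m\zeta^{10}+n\zeta+k\zeta^2+l\zeta^5\in\mathbb{Z}[\zeta]$. Units: $\mathbb{U}[\zeta]=\{\zeta^i(1+\zeta)^j:i,j\in\mathbb{Z}\}$. A (full) solution coset of $N(\alpha)=r$ is a coset $\alpha\,\mathbb{U}[\zeta]$ with $N(\alpha)=r$. Cosets obtained from each other by Galois conjugation (that is, by $\{m,n,k,l\}\mapsto\{m,-n,k,-l\},\{k,l,m,n\},\{k,-l,m,-n\}$) are identified: each coset is represented by its leader $\{m|n|k|l\}$, the triangle of minimal area in the coset, chosen among its 48 representations (12 multiplications by powers of $\zeta$ times 4 conjugations) so that $m,n\ge0$ and $m^2+n^2\ge k^2+l^2\ge(m-k)^2+(n-l)^2$. The coset is labeled by $j\in\mathbb{Z}$: label $j$ corresponds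 to the triangles $\{m|n|k|l\}(2+\sqrt3)^j$ and $\{m|n|k|l\}(2+\sqrt3)^j(\zeta+\zeta^2)$ (up to powers of $\zeta$) in the two halves of the coset. A family of solution cosets is of Class B1 if for each $j$ the triangles labeled by $j$ taken from any two cosets in the family are not congruent (in $\mathbb{R}^2$) but have the same area, and the family is the maximal one with this property. A family is of Class B2 if, for any $j$, all triangles labeled by $j$ in its cosets have the same area but some of them are congruent while some others are not, and the family is the maximal one with this property. *)

theory Defs
  imports "HOL-Analysis.Analysis" "HOL-Library.Disjoint_Sets" "HOL-Computational_Algebra.Primes"
begin

definition zeta :: complex where
  "zeta = Complex (sqrt 3 / 2) (1 / 2)"

(* The tuple (m, n, k, l) is the lattice triangle with vertices (0,0), (m,n), (k,l). *)
type_synonym triangle = "int \<times> int \<times> int \<times> int"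

fun eval_at :: "complex \<Rightarrow> triangle \<Rightarrow> complex" where
  "eval_at w (m, n, k, l) =
     of_int m * w ^ 10 + of_int n * w + of_int k * w ^ 2 + of_int l * w ^ 5"

(* The identification of triangles with elements of Z[zeta]: since
   (zeta^10, zeta, zeta^2, zeta^5) is a Z-basis of Z[zeta], this is a bijection onto Z[zeta]. *)
definition elt :: "triangle \<Rightarrow> complex" where
  "elt = eval_at zeta"

(* The Galois conjugates of elt T are obtained by replacing zeta with the other
   primitive 12th roots of unity. *)
definition norm12 :: "triangle \<Rightarrow> complex" where
  "norm12 T = (\<Prod>i\<in>{1, 5, 7, 11::nat}. eval_at (zeta ^ i) T)"

(* The substitutions zeta -> zeta, zeta^7, zeta^5, zeta^11, in this order, in coordinates. *)
fun conjugates :: "triangle \<Rightarrow> triangle set" where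
  "conjugates (m, n, k, l) = {(m, n, k, l), (m, -n, k, -l), (k, l, m, n), (k, -l, m, -n)}"

definition units12 :: "complex set" where
  "units12 = {zeta powi i * (1 + zeta) powi j | i j :: int. True}"

definition unit_coset :: "triangle \<Rightarrow> triangle set" where
  "unit_coset T = {S. \<exists>u\<in>units12. elt S = elt T * u}"

(* Galois conjugate unit cosets are identified by merging them into one set. *)
definition coset :: "triangle \<Rightarrow> triangle set" where
  "coset T = (\<Union>S\<in>conjugates T. unit_coset S)"

definition solution_cosets :: "nat \<Rightarrow> triangle set set" where
  "solution_cosets r = coset ` {T. norm12 T = of_nat r}"

fun vertices :: "triangle \<Rightarrow> (real ^ 2) set" where
  "vertices (m, n, k, l) =
     {0, vector [real_of_int m, real_of_int n], vector [real_of_int k, real_of_int l]}"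

definition area :: "triangle \<Rightarrow> real" where
  "area T = measure lebesgue (convex hull (vertices T))"

definition congruent :: "triangle \<Rightarrow> triangle \<Rightarrow> bool" where
  "congruent S T \<longleftrightarrow>
     (\<exists>f. (\<forall>x y. dist (f x) (f y) = dist x y) \<and> f ` vertices S = vertices T)"

(* The conditions on m, n and on the side lengths do not determine the orientation: reflecting
   the plane in the line x = y preserves them.  But that reflection is a Galois conjugation
   exchanging sqrt 3 and -sqrt 3 (times a power of zeta), so it would reverse the direction of
   the labelling below.  The counterclockwise leader (m l - n k >= 0) is taken throughout; with
   this choice label 0 carries the triangle of least area in either half of the coset.
   Leaders that remain tied have congruent triangles at every label. *)
fun leader_shape :: "triangle \<Rightarrow> bool" where
  "leader_shape (m, n, k, l) \<longleftrightarrow>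
     m \<ge> 0 \<and> n \<ge> 0 \<and>
     m\<^sup>2 + n\<^sup>2 \<ge> k\<^sup>2 + l\<^sup>2 \<and> k\<^sup>2 + l\<^sup>2 \<ge> (m - k)\<^sup>2 + (n - l)\<^sup>2 \<and>
     m * l - n * k \<ge> 0"

definition is_leader :: "triangle set \<Rightarrow> triangle \<Rightarrow> bool" where
  "is_leader C T \<longleftrightarrow> T \<in> C \<and> (\<forall>S\<in>C. area T \<le> area S) \<and> leader_shape T"

definition leader :: "triangle set \<Rightarrow> triangle" where
  "leader C = (SOME T. is_leader C T)"

(* The boolean h selects the half of the coset. *)
definition labelled :: "triangle set \<Rightarrow> int \<Rightarrow> bool \<Rightarrow> triangle" where
  "labelled C j h =
     inv elt (elt (leader C) * (2 + of_real (sqrt 3)) powi j * (if h then zeta + zeta ^ 2 else 1))"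

(* The two triangles carrying the same label j always have different areas, so triangles from
   different cosets are compared within the same half. *)
definition same_areas :: "triangle set set \<Rightarrow> int \<Rightarrow> bool \<Rightarrow> bool" where
  "same_areas F j h \<longleftrightarrow> (\<forall>C\<in>F. \<forall>D\<in>F. area (labelled C j h) = area (labelled D j h))"

definition B1_property :: "triangle set set \<Rightarrow> bool" where
  "B1_property F \<longleftrightarrow> (\<forall>j h. same_areas F j h \<and>
     (\<forall>C\<in>F. \<forall>D\<in>F. C \<noteq> D \<longrightarrow> \<not> congruent (labelled C j h) (labelled D j h)))"

definition B2_property :: "triangle set set \<Rightarrow> bool" where
  "B2_property F \<longleftrightarrow> (\<forall>j h. same_areas F j h \<and>
     (\<exists>C\<in>F. \<exists>D\<in>F. C \<noteq> D \<and> congruent (labelled C j h) (labelled D j h)) \<and>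
     (\<exists>C\<in>F. \<exists>D\<in>F. \<not> congruent (labelled C j h) (labelled D j h)))"

definition maximal_family :: "nat \<Rightarrow> (triangle set set \<Rightarrow> bool) \<Rightarrow> triangle set set \<Rightarrow> bool" where
  "maximal_family r P F \<longleftrightarrow>
     F \<subseteq> solution_cosets r \<and> P F \<and> (\<forall>G. F \<subset> G \<and> G \<subseteq> solution_cosets r \<longrightarrow> \<not> P G)"

definition class_B1 :: "nat \<Rightarrow> triangle set set \<Rightarrow> bool" where
  "class_B1 r = maximal_family r B1_property"

definition class_B2 :: "nat \<Rightarrow> triangle set set \<Rightarrow> bool" where
  "class_B2 r = maximal_family r B2_property"

end

theory Submission
  imports Defs "HOL-Number_Theory.Residue_Primitive_Roots"
begin

text \<open>Write the triangle with vertices \<open>0, v, w\<close> (Gaussian integers) as the element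
\<open>x = \<zeta>\<^sup>1\<^sup>0 v + \<zeta>\<^sup>2 w\<close> of \<open>\<int>[\<zeta>]\<close>. Up to sign \<open>x\<close> is the Lagrange resolvent of the three vertices, and
this is why the geometry of the triangle can be read off from relative norms of \<open>x\<close>. Let \<open>A\<close> be
half the sum of the squared side lengths and \<open>D\<close> twice the signed area.

\<^item> The norm down to \<open>\<int>[sqrt 3]\<close> is \<open>A - D sqrt 3\<close>. Hence the absolute norm is \<open>A\<^sup>2 - 3 D\<^sup>2\<close>, and among
  elements of equal norm the area determines \<open>A\<close> and \<open>\<bar>D\<bar>\<close>.
\<^item> The norm down to the Eisenstein integers has the differences of squared side lengths as its
  coordinates. Together with \<open>A\<close> it therefore determines the side lengths, so for equal \<open>A\<close> the
  congruence class is this norm up to cube roots of unity and complex conjugation.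

The ring is norm-Euclidean, so a prime \<open>p\<close> that is 1 modulo 12 is up to a unit the product of the four
Galois conjugates of an element \<open>\<pi>\<close> of norm \<open>p\<close>. Solutions of \<open>N(x) = p\<^sup>n\<close> up to units correspond to
exponent vectors \<open>(i, j, k, l)\<close> with sum \<open>n\<close>, attached to \<open>\<pi>\<close> and its images under \<open>\<zeta> \<mapsto> \<zeta>\<^sup>5, \<zeta>\<^sup>7, \<zeta>\<^sup>1\<^sup>1\<close>;
the Galois group permutes the four places regularly. The number of cosets is the number of orbits,
which Burnside's lemma gives.

The ideal generated by the norm to \<open>\<int>[sqrt 3]\<close> depends only on \<open>(i + l, j + k)\<close>, and the norms of the
elements of a coset are all the totally positive generators of this ideal and of its conjugate.
Hence the least area in the coset, and with it the area at every label, depends exactly on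
\<open>s = min (i + l) (j + k)\<close> (\<open>labelled_same_area\<close>, \<open>leader_area_sclass\<close>). In the same way the norm to
the Eisenstein integers depends on \<open>(i + k, j + l)\<close>, so two triangles of equal area are congruent
exactly when \<open>t = min (i + k) (j + l)\<close> agrees (\<open>labelled_congruent_iff\<close>). A priori this fixes the norm
only up to a sixth root of unity, but the sign is forced because the norm is \<open>A\<close> modulo the prime over 3.

The families are the classes of constant \<open>s\<close>, one for each \<open>s\<close> from 0 to \<open>n div 2\<close>. If \<open>s = 0\<close>, two
exponents vanish and \<open>t\<close> separates the remaining orbits, which gives Class B1. If \<open>s > 0\<close>, there is
enough room both for two orbits with the same \<open>t\<close> and for two different values of \<open>t\<close>, which gives
Class B2; this needs \<open>n > 2\<close>.\<close>


section \<open>The ring of twelfth cyclotomic integers\<close>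

text \<open>The type has the coordinates of the triangles, so that the ring structure, the Galois
action and the geometry all live on the same four integers: \<open>vx + i vy\<close> and \<open>wx + i wy\<close> are the two
Gaussian coefficients of \<open>\<zeta>\<^sup>1\<^sup>0\<close> and \<open>\<zeta>\<^sup>2\<close>. Multiplication follows from \<open>\<zeta>\<^sup>2\<^sup>0 = - \<zeta>\<^sup>2\<close>, \<open>\<zeta>\<^sup>4 = - \<zeta>\<^sup>1\<^sup>0\<close> and
\<open>1 = \<zeta>\<^sup>1\<^sup>0 + \<zeta>\<^sup>2\<close>, which gives \<open>(v, w) (v', w') = (v w' + w v' - w w', v w' + w v' - v v')\<close>.\<close>
datatype cyc = Cyc (vx: int) (vy: int) (wx: int) (wy: int)

lemma cyc_eq_iff: "x = y \<longleftrightarrow> vx x = vx y \<and> vy x = vy y \<and> wx x = wx y \<and> wy x = wy y"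
  by (cases x; cases y) auto

instantiation cyc :: comm_ring_1
begin

definition zero_cyc :: cyc where "0 = Cyc 0 0 0 0"
definition one_cyc :: cyc where "1 = Cyc 1 0 1 0"
definition plus_cyc :: "cyc \<Rightarrow> cyc \<Rightarrow> cyc" where
  "x + y = Cyc (vx x + vx y) (vy x + vy y) (wx x + wx y) (wy x + wy y)"
definition uminus_cyc :: "cyc \<Rightarrow> cyc" where
  "- x = Cyc (- vx x) (- vy x) (- wx x) (- wy x)"
definition minus_cyc :: "cyc \<Rightarrow> cyc \<Rightarrow> cyc" where
  "x - y = Cyc (vx x - vx y) (vy x - vy y) (wx x - wx y) (wy x - wy y)"
definition times_cyc :: "cyc \<Rightarrow> cyc \<Rightarrow> cyc" where
  "x * y = Cyc
     (vx x * wx y - vy x * wy y + wx x * vx y - wy x * vy y - wx x * wx y + wy x * wy y)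
     (vx x * wy y + vy x * wx y + wx x * vy y + wy x * vx y - wx x * wy y - wy x * wx y)
     (vx x * wx y - vy x * wy y + wx x * vx y - wy x * vy y - vx x * vx y + vy x * vy y)
     (vx x * wy y + vy x * wx y + wx x * vy y + wy x * vx y - vx x * vy y - vy x * vx y)"

instance
proof
  fix x y z :: cyc
  show "x * y * z = x * (y * z)"
    by (simp add: cyc_eq_iff times_cyc_def algebra_simps)
  show "(x + y) * z = x * z + y * z"
    by (simp add: cyc_eq_iff times_cyc_def plus_cyc_def algebra_simps)
qed (simp_all add: cyc_eq_iff times_cyc_def plus_cyc_def minus_cyc_def uminus_cyc_def
       zero_cyc_def one_cyc_def algebra_simps)

end

lemma coords [simp]:
  "vx 0 = 0" "vy 0 = 0" "wx 0 = 0" "wy 0 = 0"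
  "vx 1 = 1" "vy 1 = 0" "wx 1 = 1" "wy 1 = 0"
  "vx (x + y) = vx x + vx y" "vy (x + y) = vy x + vy y"
  "wx (x + y) = wx x + wx y" "wy (x + y) = wy x + wy y"
  "vx (x - y) = vx x - vx y" "vy (x - y) = vy x - vy y"
  "wx (x - y) = wx x - wx y" "wy (x - y) = wy x - wy y"
  "vx (- x) = - vx x" "vy (- x) = - vy x" "wx (- x) = - wx x" "wy (- x) = - wy x"
  by (simp_all add: plus_cyc_def minus_cyc_def uminus_cyc_def zero_cyc_def one_cyc_def)

lemma of_int_cyc: "of_int a = Cyc a 0 a 0"
proof -
  have n: "of_nat b = Cyc (int b) 0 (int b) 0" for b
    by (induction b) (simp_all add: cyc_eq_iff)
  show ?thesis
    by (cases a rule: int_cases2) (simp_all add: n cyc_eq_iff)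
qed

text \<open>The automorphism \<open>\<zeta> \<mapsto> \<zeta>\<^sup>a\<close> is \<open>ga\<close>. It acts on triangles by swapping the two vertices
(5), by complex conjugation of both (7), or by both operations (11).\<close>
definition g5 :: "cyc \<Rightarrow> cyc" where "g5 x = Cyc (wx x) (wy x) (vx x) (vy x)"
definition g7 :: "cyc \<Rightarrow> cyc" where "g7 x = Cyc (vx x) (- vy x) (wx x) (- wy x)"
definition g11 :: "cyc \<Rightarrow> cyc" where "g11 x = Cyc (wx x) (- wy x) (vx x) (- vy x)"

lemma galois_comp [simp]:
  "g5 (g5 x) = x" "g7 (g7 x) = x" "g11 (g11 x) = x"
  "g5 (g7 x) = g11 x" "g7 (g5 x) = g11 x" "g5 (g11 x) = g7 x" "g11 (g5 x) = g7 x"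
  "g7 (g11 x) = g5 x" "g11 (g7 x) = g5 x"
  by (simp_all add: g5_def g7_def g11_def)

lemma galois_mult [simp]:
  "g5 (x * y) = g5 x * g5 y" "g7 (x * y) = g7 x * g7 y" "g11 (x * y) = g11 x * g11 y"
  by (simp_all add: g5_def g7_def g11_def times_cyc_def algebra_simps)

lemma galois_one [simp]: "g5 1 = 1" "g7 1 = 1" "g11 1 = 1"
  by (simp_all add: g5_def g7_def g11_def one_cyc_def)

lemma galois_power [simp]:
  "g5 (x ^ n) = g5 x ^ n" "g7 (x ^ n) = g7 x ^ n" "g11 (x ^ n) = g11 x ^ n"
  by (induction n) simp_all

text \<open>Half the sum of the squared side lengths (see \<open>qform_sides\<close>), twice the signed area, and the
absolute norm.\<close>
definition qform :: "cyc \<Rightarrow> int" where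
  "qform x = (vx x)\<^sup>2 + (vy x)\<^sup>2 + (wx x)\<^sup>2 + (wy x)\<^sup>2 - vx x * wx x - vy x * wy x"
definition darea :: "cyc \<Rightarrow> int" where
  "darea x = vx x * wy x - vy x * wx x"
definition cnorm :: "cyc \<Rightarrow> int" where
  "cnorm x = (qform x)\<^sup>2 - 3 * (darea x)\<^sup>2"

lemma qform_mult: "qform (x * y) = qform x * qform y + 3 * darea x * darea y"
  by (simp add: qform_def darea_def times_cyc_def power2_eq_square algebra_simps)

lemma darea_mult: "darea (x * y) = qform x * darea y + darea x * qform y"
  by (simp add: qform_def darea_def times_cyc_def power2_eq_square algebra_simps)

lemma cnorm_mult: "cnorm (x * y) = cnorm x * cnorm y"
  by (simp add: cnorm_def qform_mult darea_mult power2_eq_square algebra_simps)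

lemma galois_qform [simp]: "qform (g5 x) = qform x" "qform (g7 x) = qform x" "qform (g11 x) = qform x"
  by (simp_all add: qform_def g5_def g7_def g11_def algebra_simps)

lemma galois_darea [simp]:
  "darea (g5 x) = - darea x" "darea (g7 x) = - darea x" "darea (g11 x) = darea x"
  by (simp_all add: darea_def g5_def g7_def g11_def algebra_simps)

lemma galois_cnorm [simp]: "cnorm (g5 x) = cnorm x" "cnorm (g7 x) = cnorm x" "cnorm (g11 x) = cnorm x"
  by (simp_all add: cnorm_def)

text \<open>Because \<open>sqrt 3 = \<zeta> - \<zeta>\<^sup>5\<close>, the right-hand side is \<open>qform x - darea x * sqrt 3\<close>.\<close>
lemma rel_norm_sqrt3: "x * g11 x = Cyc (qform x) (- darea x) (qform x) (darea x)"
  by (simp add: times_cyc_def g11_def qform_def darea_def power2_eq_square algebra_simps)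

lemma cnorm_galois: "x * g5 x * g7 x * g11 x = of_int (cnorm x)"
proof -
  have "x * g5 x * g7 x * g11 x = (x * g11 x) * g5 (x * g11 x)" by (simp add: mult_ac)
  also have "\<dots> = of_int (cnorm x)"
    unfolding rel_norm_sqrt3
    by (simp add: g5_def times_cyc_def of_int_cyc cnorm_def power2_eq_square algebra_simps)
  finally show ?thesis .
qed

definition side1 :: "cyc \<Rightarrow> int" where "side1 x = (vx x)\<^sup>2 + (vy x)\<^sup>2"
definition side2 :: "cyc \<Rightarrow> int" where "side2 x = (wx x)\<^sup>2 + (wy x)\<^sup>2"
definition side3 :: "cyc \<Rightarrow> int" where "side3 x = (vx x - wx x)\<^sup>2 + (vy x - wy x)\<^sup>2"
lemmas side_defs = side1_def side2_def side3_def

text \<open>The two coordinates left, at \<open>\<zeta>\<^sup>1\<^sup>0\<close> and \<open>\<zeta>\<^sup>2\<close>, span the Eisenstein integers.\<close>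
lemma rel_norm_sqrtm3: "x * g7 x = Cyc (side1 x - side3 x) 0 (side2 x - side3 x) 0"
  by (simp add: times_cyc_def g7_def side_defs power2_eq_square algebra_simps)

lemma qform_sides: "2 * qform x = side1 x + side2 x + side3 x"
  by (simp add: qform_def side_defs power2_eq_square algebra_simps)

lemma cnorm_sides:
  "cnorm x = (side1 x - side3 x)\<^sup>2 + (side2 x - side3 x)\<^sup>2 - (side1 x - side3 x) * (side2 x - side3 x)"
  by (simp add: cnorm_def qform_def darea_def side_defs power2_eq_square algebra_simps)

lemma hex_nonneg: "(a::int)\<^sup>2 + b\<^sup>2 - a * b \<ge> 0"
proof -
  have "2 * (a\<^sup>2 + b\<^sup>2 - a * b) = a\<^sup>2 + b\<^sup>2 + (a - b)\<^sup>2"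
    by (simp add: power2_eq_square algebra_simps)
  then show ?thesis by (smt (verit) zero_le_power2)
qed

text \<open>As a norm from the Eisenstein integers, the absolute norm is a value of a positive definite form;
the expression by \<open>qform\<close> and \<open>darea\<close> would not show this.\<close>
lemma cnorm_nonneg: "cnorm x \<ge> 0"
  unfolding cnorm_sides by (rule hex_nonneg)

lemma qform_nonneg: "qform x \<ge> 0"
  using qform_sides[of x] unfolding side_defs by (smt (verit) zero_le_power2)

lemma qform_0_iff: "qform x = 0 \<longleftrightarrow> x = 0"
proof
  assume "qform x = 0"
  then have "side1 x + side2 x + side3 x = 0" using qform_sides[of x] by simp
  then have "(vx x)\<^sup>2 = 0" "(vy x)\<^sup>2 = 0" "(wx x)\<^sup>2 = 0" "(wy x)\<^sup>2 = 0"
    unfolding side_defs by (smt (verit) zero_le_power2)+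
  then show "x = 0" by (simp add: cyc_eq_iff)
qed (simp add: qform_def)

lemma three_square: "(a::int)\<^sup>2 = 3 * b\<^sup>2 \<Longrightarrow> b = 0"
proof (rule ccontr)
  assume eq: "a\<^sup>2 = 3 * b\<^sup>2" and b: "b \<noteq> 0"
  then have a: "a \<noteq> 0" by auto
  have p3: "prime (3::int)" by simp
  have "multiplicity 3 (a\<^sup>2) = multiplicity 3 (3 * b\<^sup>2)" using eq by simp
  then have "2 * multiplicity 3 a = 1 + 2 * multiplicity 3 b"
    using a b p3 by (simp add: prime_elem_multiplicity_mult_distrib prime_elem_multiplicity_power_distrib)
  then show False by presburger
qed

lemma cnorm_0_iff: "cnorm x = 0 \<longleftrightarrow> x = 0"
proof
  assume "cnorm x = 0"
  then have e: "(qform x)\<^sup>2 = 3 * (darea x)\<^sup>2" by (simp add: cnorm_def)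
  then have "darea x = 0" by (rule three_square)
  with e have "qform x = 0" by simp
  then show "x = 0" by (simp add: qform_0_iff)
qed (simp add: cnorm_def qform_def darea_def)

instance cyc :: idom
proof
  fix x y :: cyc
  assume "x \<noteq> 0" "y \<noteq> 0"
  then have "cnorm (x * y) \<noteq> 0" by (simp add: cnorm_mult cnorm_0_iff)
  then show "x * y \<noteq> 0" by (simp add: cnorm_0_iff)
qed

lemma cnorm_of_int: "cnorm (of_int a) = a ^ 4"
  by (simp add: of_int_cyc cnorm_def qform_def darea_def power2_eq_square power4_eq_xxxx algebra_simps)

lemma cnorm_1 [simp]: "cnorm 1 = 1"
  by (simp add: cnorm_def qform_def darea_def)

lemma cnorm_power: "cnorm (x ^ n) = cnorm x ^ n"
  by (induction n) (simp_all add: cnorm_mult)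

section \<open>Triangles as complex numbers\<close>

definition cyc_of :: "triangle \<Rightarrow> cyc" where
  "cyc_of = (\<lambda>(m, n, k, l). Cyc m n k l)"
definition tri :: "cyc \<Rightarrow> triangle" where
  "tri x = (vx x, vy x, wx x, wy x)"

lemma tri_cyc_of [simp]: "tri (cyc_of T) = T"
  by (cases T) (simp add: tri_def cyc_of_def)
lemma cyc_of_tri [simp]: "cyc_of (tri x) = x"
  by (simp add: tri_def cyc_of_def)

definition cx :: "cyc \<Rightarrow> complex" where "cx x = elt (tri x)"

lemma elt_cx: "elt T = cx (cyc_of T)" by (simp add: cx_def)

definition zt :: cyc where "zt = Cyc 0 1 0 0"

lemma zeta_powers:
  "zeta ^ 2 = Complex (1/2) (sqrt 3 / 2)" "zeta ^ 3 = \<i>" "zeta ^ 5 = Complex (- sqrt 3 / 2) (1/2)"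
  "zeta ^ 10 = Complex (1/2) (- sqrt 3 / 2)" "zeta ^ 12 = 1"
proof -
  show z2: "zeta ^ 2 = Complex (1/2) (sqrt 3 / 2)"
    by (simp add: zeta_def complex_eq_iff power2_eq_square)
  have "zeta ^ 3 = zeta ^ 2 * zeta" by (simp add: eval_nat_numeral)
  then show z3: "zeta ^ 3 = \<i>" unfolding z2 by (simp add: zeta_def complex_eq_iff)
  have "zeta ^ 5 = zeta ^ 2 * zeta ^ 3" by (simp flip: power_add)
  then show z5: "zeta ^ 5 = Complex (- sqrt 3 / 2) (1/2)" unfolding z2 z3
    by (simp add: complex_eq_iff)
  have "zeta ^ 10 = zeta ^ 5 * zeta ^ 5" by (simp flip: power_add)
  then show z10: "zeta ^ 10 = Complex (1/2) (- sqrt 3 / 2)" unfolding z5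
    by (simp add: complex_eq_iff)
  have "zeta ^ 12 = zeta ^ 2 * zeta ^ 10" by (simp flip: power_add)
  then show "zeta ^ 12 = 1" unfolding z2 z10 by (simp add: complex_eq_iff)
qed

lemma cx_complex: "cx x = Complex ((vx x + wx x) / 2 + sqrt 3 * (vy x - wy x) / 2)
                     ((vy x + wy x) / 2 + sqrt 3 * (wx x - vx x) / 2)"
  unfolding cx_def tri_def elt_def eval_at.simps zeta_powers
  by (simp add: complex_eq_iff zeta_def field_simps)

lemma cx_add: "cx (x + y) = cx x + cx y"
  by (simp add: cx_complex complex_eq_iff field_simps)
lemma cx_diff: "cx (x - y) = cx x - cx y"
  by (simp add: cx_complex complex_eq_iff field_simps)

lemma cx_mult: "cx (x * y) = cx x * cx y"
proof -
  have r: "sqrt 3 * (sqrt 3 * a) = 3 * a" for a :: real by (simp flip: mult.assoc)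
  show ?thesis
    by (simp add: cx_complex complex_eq_iff times_cyc_def field_simps r)
qed

lemma cx_1 [simp]: "cx 1 = 1"
  by (simp add: cx_complex complex_eq_iff)
lemma cx_0 [simp]: "cx 0 = 0"
  by (simp add: cx_complex complex_eq_iff)

lemma cx_of_int: "cx (of_int a) = of_int a"
  by (simp add: cx_complex complex_eq_iff of_int_cyc)

lemma cx_power: "cx (x ^ n) = cx x ^ n"
  by (induction n) (simp_all add: cx_mult)

lemma cx_zt: "cx zt = zeta"
  by (simp add: cx_complex zt_def zeta_def complex_eq_iff)

lemma cx_cnorm: "cx x * cx (g5 x) * cx (g7 x) * cx (g11 x) = of_int (cnorm x)"
  by (metis cnorm_galois cx_mult cx_of_int)

text \<open>The absolute norm of \<open>x\<close> is a product of four complex numbers one of which is \<open>cx x\<close>, so \<open>cx\<close> is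
injective because only 0 has norm 0.\<close>
lemma cx_0_iff: "cx x = 0 \<longleftrightarrow> x = 0"
proof
  assume "cx x = 0"
  then have "of_int (cnorm x) = (0::complex)" using cx_cnorm[of x] by simp
  then show "x = 0" by (simp add: cnorm_0_iff)
qed simp

lemma cx_eq_iff: "cx x = cx y \<longleftrightarrow> x = y"
  using cx_0_iff[of "x - y"] by (simp add: cx_diff)

lemma inv_elt_cx: "inv_into UNIV elt (cx x) = tri x"
proof -
  have "inj elt" by (rule injI) (metis cx_eq_iff elt_cx tri_cyc_of)
  then show ?thesis by (simp add: cx_def inv_f_f)
qed

lemma norm12_cnorm: "norm12 T = of_int (cnorm (cyc_of T))"
proof -
  obtain m n k l where T: "T = (m, n, k, l)" by (cases T)
  define x where "x = cyc_of T"
  have red: "zeta ^ a = zeta ^ (a mod 12)" for a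
  proof -
    have "zeta ^ a = zeta ^ (12 * (a div 12) + a mod 12)" by simp
    also have "\<dots> = zeta ^ (a mod 12)" by (simp only: power_add power_mult zeta_powers) simp
    finally show ?thesis .
  qed
  have z6: "zeta ^ 6 = -1"
    using zeta_powers(2) power_mult[of zeta 3 2] by simp
  have z7: "zeta ^ 7 = - zeta" and z11: "zeta ^ 11 = - (zeta ^ 5)"
    using z6 power_add[of zeta 6 1] power_add[of zeta 6 5] by simp_all
  have c1: "eval_at (zeta ^ 1) T = cx x"
    by (simp add: x_def cx_def elt_def)
  have c5: "eval_at (zeta ^ 5) T = cx (g5 x)"
    by (simp add: x_def cx_def elt_def tri_def cyc_of_def g5_def T flip: power_mult)
       (simp add: red[of 50] red[of 25])
  have c7: "eval_at (zeta ^ 7) T = cx (g7 x)"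
    by (simp add: x_def cx_def elt_def tri_def cyc_of_def g7_def T flip: power_mult)
       (simp add: red[of 70] red[of 14] red[of 35] z7 z11)
  have c11: "eval_at (zeta ^ 11) T = cx (g11 x)"
    by (simp add: x_def cx_def elt_def tri_def cyc_of_def g11_def T flip: power_mult)
       (simp add: red[of 110] red[of 22] red[of 55] z7 z11)
  have "norm12 T = eval_at (zeta ^ 1) T * eval_at (zeta ^ 5) T * eval_at (zeta ^ 7) T * eval_at (zeta ^ 11) T"
    unfolding norm12_def by (simp del: power_one_right One_nat_def add: mult_ac)
  then show ?thesis unfolding c1 c5 c7 c11 cx_cnorm x_def .
qed

lemma conjugates_galois:
  "conjugates T = (let x = cyc_of T in {T, tri (g7 x), tri (g5 x), tri (g11 x)})"
  by (cases T) (simp add: cyc_of_def tri_def g5_def g7_def g11_def Let_def)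

lemma cnorm_zt: "cnorm zt = 1" by (simp add: zt_def cnorm_def qform_def darea_def)
text \<open>Geometrically: multiplication by \<open>\<zeta>\<close> takes the triangle \<open>0, v, w\<close> to \<open>0, i w, i (w - v)\<close>,
which is the same triangle seen from the vertex \<open>w\<close>.\<close>
lemma zt_mult: "zt * x = Cyc (- wy x) (wx x) (vy x - wy x) (wx x - vx x)"
  by (simp add: zt_def times_cyc_def)

lemma zt_powers: "zt ^ 2 = Cyc 0 0 1 0" "zt ^ 3 = Cyc 0 1 0 1" "zt ^ 4 = Cyc (-1) 0 0 0"
   "zt ^ 5 = Cyc 0 0 0 1" "zt ^ 6 = - 1"
  by (simp_all add: eval_nat_numeral zt_mult cyc_eq_iff) (simp_all add: zt_def)

lemma zt_12: "zt ^ 12 = 1"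
  using power_mult[of zt 6 2] by (simp add: zt_powers)


section \<open>The unit group\<close>

text \<open>The fundamental unit \<open>1 + \<zeta>\<close> and its inverse \<open>\<zeta>\<^sup>2 (1 - \<zeta>) = \<zeta>\<^sup>2 - \<zeta>\<^sup>3\<close>. Their norms to \<open>\<int>[sqrt 3]\<close> are
\<open>2 + sqrt 3\<close> and \<open>2 - sqrt 3\<close>.\<close>
definition fu :: cyc where "fu = 1 + zt"
definition fu_inv :: cyc where "fu_inv = Cyc 0 (-1) 1 (-1)"

lemma fu_props: "fu * fu_inv = 1" "cnorm fu = 1" "cnorm fu_inv = 1" "qform fu = 2" "qform fu_inv = 2"
   "darea fu = -1" "darea fu_inv = 1"
  by (simp_all add: fu_def fu_inv_def zt_def cyc_eq_iff times_cyc_def one_cyc_def plus_cyc_def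
       cnorm_def qform_def darea_def)

lemma hex_zero: "(a::int)\<^sup>2 + b\<^sup>2 - a * b = 0 \<Longrightarrow> a = 0 \<and> b = 0"
proof -
  assume "a\<^sup>2 + b\<^sup>2 - a * b = 0"
  then have "a\<^sup>2 + b\<^sup>2 + (a - b)\<^sup>2 = 0"
    by (simp add: power2_eq_square algebra_simps)
  then show ?thesis by (simp add: add_nonneg_eq_0_iff)
qed

lemma hex_unit:
  assumes "(a::int)\<^sup>2 + b\<^sup>2 - a * b = 1"
  shows "\<exists>i. Cyc a 0 b 0 = zt ^ (2 * i)"
proof -
  have "a\<^sup>2 + b\<^sup>2 + (a - b)\<^sup>2 = 2"
    using assms by (simp add: power2_eq_square algebra_simps)
  with zero_le_power2[of a] zero_le_power2[of b] zero_le_power2[of "a - b"]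
  have "a\<^sup>2 < 4 \<and> b\<^sup>2 < 4" by linarith
  then have "a\<^sup>2 < 2\<^sup>2" "b\<^sup>2 < 2\<^sup>2" by simp_all
  then have "\<bar>a\<bar> < 2" "\<bar>b\<bar> < 2"
    using power2_less_imp_less[of "\<bar>a\<bar>" 2] power2_less_imp_less[of "\<bar>b\<bar>" 2] by simp_all
  then have "a \<in> {-1, 0, 1}" "b \<in> {-1, 0, 1}" by auto
  with assms have c: "(a, b) \<in> {(1, 1), (0, 1), (-1, 0), (-1, -1), (0, -1), (1, 0)}"
    by (auto simp: power2_eq_square)
  have p: "zt ^ 8 = - (zt ^ 2)" "zt ^ 10 = - (zt ^ 4)"
    using power_add[of zt 6 2] power_add[of zt 6 4] by (simp_all add: zt_powers)
  have "\<exists>i\<in>{0, 1, 2, 3, 4, 5}. Cyc a 0 b 0 = zt ^ (2 * i)"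
    using c by (auto simp: zt_powers p cyc_eq_iff)
  then show ?thesis by blast
qed

text \<open>Descent on the area. If \<open>D = 0\<close>, then \<open>A = 1\<close> leaves only the twelve roots of unity. Otherwise
\<open>A\<^sup>2 = 3 D\<^sup>2 + 1\<close> lies strictly between \<open>D\<^sup>2\<close> and \<open>(3 D)\<^sup>2\<close>, so multiplying \<open>A - D sqrt 3\<close> by \<open>2 + sqrt 3\<close> or its
inverse, according to the sign of \<open>D\<close>, replaces \<open>D\<close> by \<open>\<plusminus> (2 \<bar>D\<bar> - A)\<close>, which is smaller.\<close>
lemma unit_power_form:
  assumes "cnorm u = 1"
  shows "\<exists>i j k. u = zt ^ i * fu ^ j * fu_inv ^ k"
  using assms
proof (induction "nat \<bar>darea u\<bar>" arbitrary: u rule: less_induct)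
  case less
  let ?A = "qform u" and ?D = "darea u"
  have eq: "?A\<^sup>2 = 1 + 3 * ?D\<^sup>2" using less.prems by (simp add: cnorm_def)
  have A0: "?A \<ge> 0" by (rule qform_nonneg)
  show ?case
  proof (cases "?D = 0")
    case True
    with eq A0 have A1: "?A = 1" by (simp add: power2_eq_1_iff)
    let ?P = "(vx u)\<^sup>2 + (wx u)\<^sup>2 - vx u * wx u" and ?Q = "(vy u)\<^sup>2 + (wy u)\<^sup>2 - vy u * wy u"
    have "?P + ?Q = 1" using A1 by (simp add: qform_def)
    with hex_nonneg[of "vx u" "wx u"] hex_nonneg[of "vy u" "wy u"]
    have "(?P = 1 \<and> ?Q = 0) \<or> (?P = 0 \<and> ?Q = 1)" by linarith
    then have "\<exists>i. u = zt ^ i"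
    proof
      assume a: "?P = 1 \<and> ?Q = 0"
      then have "vy u = 0 \<and> wy u = 0" by (intro hex_zero) simp
      then have "u = Cyc (vx u) 0 (wx u) 0" by (simp add: cyc_eq_iff)
      then show ?thesis using hex_unit a by metis
    next
      assume a: "?P = 0 \<and> ?Q = 1"
      then have "vx u = 0 \<and> wx u = 0" by (intro hex_zero) simp
      then have "u = zt ^ 3 * Cyc (vy u) 0 (wy u) 0"
        by (simp add: cyc_eq_iff zt_powers times_cyc_def)
      then show ?thesis using hex_unit a by (metis power_add)
    qed
    then show ?thesis by (metis mult_1_right power_0)
  next
    case False
    have sq: "?D\<^sup>2 \<ge> 1" using False by (simp add: int_one_le_iff_zero_less)
    have b1: "\<bar>?D\<bar> < ?A"
      by (rule power2_less_imp_less[OF _ A0]) (use eq sq in simp)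
    have b2: "?A < 3 * \<bar>?D\<bar>"
      by (rule power2_less_imp_less) (use eq sq in \<open>simp_all add: power_mult_distrib\<close>)
    show ?thesis
    proof (cases "?D > 0")
      case True
      have "darea (u * fu) = 2 * ?D - ?A" by (simp add: darea_mult fu_props)
      then have "nat \<bar>darea (u * fu)\<bar> < nat \<bar>?D\<bar>" using True b1 b2 by linarith
      then obtain i j k where "u * fu = zt ^ i * fu ^ j * fu_inv ^ k"
        using less.hyps[of "u * fu"] less.prems by (auto simp: cnorm_mult fu_props)
      then have "u * fu * fu_inv = zt ^ i * fu ^ j * fu_inv ^ Suc k" by (simp add: mult_ac)
      then show ?thesis by (metis fu_props(1) mult.assoc mult_1_right)
    next
      case F: False
      have "darea (u * fu_inv) = 2 * ?D + ?A" by (simp add: darea_mult fu_props)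
      then have "nat \<bar>darea (u * fu_inv)\<bar> < nat \<bar>?D\<bar>" using F False b1 b2 by linarith
      then obtain i j k where "u * fu_inv = zt ^ i * fu ^ j * fu_inv ^ k"
        using less.hyps[of "u * fu_inv"] less.prems by (auto simp: cnorm_mult fu_props)
      then have "u * fu_inv * fu = zt ^ i * fu ^ Suc j * fu_inv ^ k" by (simp add: mult_ac)
      then show ?thesis by (metis fu_props(1) mult.assoc mult.commute mult_1_right)
    qed
  qed
qed

lemma cx_fu: "cx fu = 1 + zeta" by (simp add: fu_def cx_add cx_zt)
lemma cx_fu_inv: "cx fu_inv = inverse (1 + zeta)"
  by (metis cx_1 cx_fu cx_mult fu_props(1) inverse_unique)

lemma fu_nonzero: "1 + zeta \<noteq> 0"
  by (metis cx_0_iff cx_fu cnorm_0_iff fu_props(2) zero_neq_one)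
lemma unit_inverse:
  assumes "cnorm u = 1"
  obtains u' where "cnorm u' = 1" "u * u' = 1"
proof
  show "cnorm (g5 u * g7 u * g11 u) = 1" by (simp add: cnorm_mult assms)
  show "u * (g5 u * g7 u * g11 u) = 1" using cnorm_galois[of u] by (simp add: assms mult.assoc)
qed

lemma unit_powi:
  assumes "cnorm u = 1"
  shows "\<exists>x. cx u powi j = cx x \<and> cnorm x = 1"
proof (cases "j \<ge> 0")
  case True
  then have "cx u powi j = cx (u ^ nat j)" by (simp add: cx_power power_int_def)
  then show ?thesis by (auto simp: cnorm_power assms)
next
  case False
  obtain u' where u': "cnorm u' = 1" "u * u' = 1" using unit_inverse[OF assms] .
  then have "inverse (cx u) = cx u'" by (metis cx_1 cx_mult inverse_unique)
  with False have "cx u powi j = cx (u' ^ nat (- j))"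
    by (simp add: cx_power power_int_def power_inverse)
  then show ?thesis using u' by (auto simp: cnorm_power)
qed

text \<open>This turns membership in a unit coset into the condition that a quotient has norm 1.\<close>
theorem units12_eq: "units12 = cx ` {u. cnorm u = 1}"
proof
  show "units12 \<subseteq> cx ` {u. cnorm u = 1}"
  proof
    fix z assume "z \<in> units12"
    then obtain i j where z: "z = zeta powi i * (1 + zeta) powi j" by (auto simp: units12_def)
    obtain x y where "zeta powi i = cx x" "cnorm x = 1" "(1 + zeta) powi j = cx y" "cnorm y = 1"
      using unit_powi[OF cnorm_zt, of i] unit_powi[OF fu_props(2), of j] unfolding cx_zt cx_fu by blast
    then show "z \<in> cx ` {u. cnorm u = 1}"
      unfolding z by (intro image_eqI[of _ _ "x * y"]) (simp_all add: cx_mult cnorm_mult)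
  qed
next
  show "cx ` {u. cnorm u = 1} \<subseteq> units12"
  proof clarify
    fix u assume "cnorm u = 1"
    then obtain i j k where u: "u = zt ^ i * fu ^ j * fu_inv ^ k" using unit_power_form by blast
    have "cx u = zeta ^ i * (1 + zeta) ^ j * inverse (1 + zeta) ^ k"
      by (simp add: u cx_mult cx_power cx_zt cx_fu cx_fu_inv)
    also have "\<dots> = zeta powi int i * ((1 + zeta) powi int j * (1 + zeta) powi (- int k))"
      by (simp add: power_int_minus power_inverse)
    also have "\<dots> = zeta powi int i * (1 + zeta) powi (int j - int k)"
      by (simp only: power_int_add[OF disjI1[OF fu_nonzero], symmetric]) simp
    finally show "cx u \<in> units12" unfolding units12_def by blast
  qed
qed

lemma unit_coset_cyc: "S \<in> unit_coset T \<longleftrightarrow> (\<exists>u. cnorm u = 1 \<and> cyc_of S = u * cyc_of T)"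
proof -
  have "S \<in> unit_coset T \<longleftrightarrow> (\<exists>u. cnorm u = 1 \<and> cx (cyc_of S) = cx (u * cyc_of T))"
    unfolding unit_coset_def units12_eq elt_cx by (auto simp: cx_mult mult.commute)
  then show ?thesis by (simp add: cx_eq_iff)
qed

lemma coset_cyc: "S \<in> coset T \<longleftrightarrow> (\<exists>u y. cnorm u = 1 \<and> cyc_of S = u * y \<and>
     y \<in> {cyc_of T, g5 (cyc_of T), g7 (cyc_of T), g11 (cyc_of T)})"
  unfolding coset_def conjugates_galois Let_def
  by (auto simp: unit_coset_cyc)

section \<open>Euclidean division\<close>

text \<open>The hexagonal lattice has covering radius \<open>1 / sqrt 3\<close>. In barycentric coordinates of the lattice
triangle of side \<open>N\<close> around the point, the weighted mean of the squared distances to its three corners is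
\<open>N\<^sup>2\<close> times the sum of the pairwise products of the weights, hence at most \<open>N\<^sup>2 / 3\<close>; some corner does not
exceed the mean.\<close>
lemma hex_round_aux:
  fixes e f N :: int
  assumes "0 \<le> f" "f \<le> e" "e < N"
  shows "\<exists>a b. 3 * ((e - a * N)\<^sup>2 + (f - b * N)\<^sup>2 - (e - a * N) * (f - b * N)) \<le> N\<^sup>2"
proof (rule ccontr)
  define Q where "Q a b = 3 * ((e - a * N)\<^sup>2 + (f - b * N)\<^sup>2 - (e - a * N) * (f - b * N))" for a b
  assume "\<not> ?thesis"
  then have far: "N\<^sup>2 < Q a b" for a b unfolding Q_def by (simp add: not_le)
  have "(N - e) * N\<^sup>2 < (N - e) * Q 0 0" by (rule mult_strict_left_mono[OF far]) (use assms in simp)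
  moreover have "(e - f) * N\<^sup>2 \<le> (e - f) * Q 1 0"
    by (rule mult_left_mono[OF less_imp_le[OF far]]) (use assms in simp)
  moreover have "f * N\<^sup>2 \<le> f * Q 1 1"
    by (rule mult_left_mono[OF less_imp_le[OF far]]) (use assms in simp)
  ultimately have lt: "(N - e) * N\<^sup>2 + (e - f) * N\<^sup>2 + f * N\<^sup>2 < (N - e) * Q 0 0 + (e - f) * Q 1 0 + f * Q 1 1"
    by (intro add_less_le_mono)
  define X where "X = (N - e) * (e - f) + (N - e) * f + (e - f) * f"
  have e1: "(N - e) * Q 0 0 + (e - f) * Q 1 0 + f * Q 1 1 = N * (3 * X)"
    by (simp add: Q_def X_def power2_eq_square algebra_simps)
  have e2: "(N - e) * N\<^sup>2 + (e - f) * N\<^sup>2 + f * N\<^sup>2 = N * N\<^sup>2"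
    by (simp add: algebra_simps)
  have "N * N\<^sup>2 < N * (3 * X)" using lt unfolding e1 e2 .
  moreover have "N > 0" using assms by simp
  ultimately have "N\<^sup>2 < 3 * X" by (rule mult_left_less_imp_less[OF _ less_imp_le])
  moreover have "0 \<le> (N - e - (e - f))\<^sup>2 + (N - e - f)\<^sup>2 + (e - f - f)\<^sup>2" by simp
  then have "3 * X \<le> N\<^sup>2"
    by (simp add: X_def power2_eq_square algebra_simps)
  ultimately show False by simp
qed

lemma hex_round:
  fixes m k N :: int
  assumes "N > 0"
  shows "\<exists>a b. 3 * ((m - a * N)\<^sup>2 + (k - b * N)\<^sup>2 - (m - a * N) * (k - b * N)) \<le> N\<^sup>2"
proof -
  have b: "0 \<le> m mod N" "m mod N < N" "0 \<le> k mod N" "k mod N < N"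
    using assms by (simp_all add: pos_mod_sign pos_mod_bound)
  have "\<exists>a b. 3 * ((m mod N - a * N)\<^sup>2 + (k mod N - b * N)\<^sup>2 - (m mod N - a * N) * (k mod N - b * N)) \<le> N\<^sup>2"
  proof (cases "k mod N \<le> m mod N")
    case True
    then show ?thesis using hex_round_aux b by blast
  next
    case False
    then obtain a b where "3 * ((k mod N - a * N)\<^sup>2 + (m mod N - b * N)\<^sup>2 - (k mod N - a * N) * (m mod N - b * N)) \<le> N\<^sup>2"
      using hex_round_aux[of "m mod N" "k mod N" N] b by auto
    then show ?thesis by (intro exI[of _ b] exI[of _ a]) (simp add: mult_ac add_ac)
  qed
  then obtain a b where *: "3 * ((m mod N - a * N)\<^sup>2 + (k mod N - b * N)\<^sup>2 - (m mod N - a * N) * (k mod N - b * N)) \<le> N\<^sup>2"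
    by blast
  have "m mod N - a * N = m - (m div N + a) * N" "k mod N - b * N = k - (k div N + b) * N"
    by (simp_all add: minus_div_mult_eq_mod[symmetric] algebra_simps)
  with * show ?thesis by (simp only:) blast
qed

text \<open>On quotients, \<open>qform\<close> is the sum of two hexagonal forms, one in the real and one in the imaginary
parts, so rounding both leaves \<open>A \<le> 2/3\<close>. Since the norm is at most \<open>A\<^sup>2\<close>, it becomes at most \<open>4/9\<close>.
To stay in the integers, the division is carried out after multiplying by the other three conjugates
of \<open>y\<close>.\<close>
lemma euclidean_division:
  fixes x y :: cyc
  assumes "y \<noteq> 0"
  shows "\<exists>q. cnorm (x - q * y) < cnorm y"
proof -
  define N where "N = cnorm y"
  \<comment> \<open>\<open>x / y = x yc / N\<close> with an integer denominator \<open>N\<close>\<close>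
  define yc where "yc = g5 y * g7 y * g11 y"
  have N0: "N > 0" using assms cnorm_nonneg[of y] cnorm_0_iff[of y] unfolding N_def by linarith
  have yyc: "y * yc = of_int N" using cnorm_galois[of y] by (simp add: yc_def N_def mult.assoc)
  have ncN: "cnorm yc = N ^ 3" by (simp add: yc_def cnorm_mult N_def eval_nat_numeral)
  define z where "z = x * yc"
  obtain a c where 1: "3 * ((vx z - a * N)\<^sup>2 + (wx z - c * N)\<^sup>2 - (vx z - a * N) * (wx z - c * N)) \<le> N\<^sup>2"
    using hex_round[OF N0] by blast
  obtain b d where 2: "3 * ((vy z - b * N)\<^sup>2 + (wy z - d * N)\<^sup>2 - (vy z - b * N) * (wy z - d * N)) \<le> N\<^sup>2"
    using hex_round[OF N0] by blast
  define q where "q = Cyc a b c d"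
  define e where "e = z - q * of_int N"
  have e_coords: "vx e = vx z - a * N" "vy e = vy z - b * N" "wx e = wx z - c * N" "wy e = wy z - d * N"
    by (simp_all add: e_def q_def of_int_cyc times_cyc_def algebra_simps)
  have "3 * qform e \<le> 2 * N\<^sup>2" using 1 2 by (simp add: qform_def e_coords)
  moreover have "N\<^sup>2 > 0" using N0 by simp
  ultimately have "qform e < N\<^sup>2" by linarith
  then have "(qform e)\<^sup>2 < (N\<^sup>2)\<^sup>2"
    using qform_nonneg[of e] by (rule power_strict_mono) simp
  then have "cnorm e < (N\<^sup>2)\<^sup>2"
    using zero_le_power2[of "darea e"] unfolding cnorm_def by linarith
  also have "(N\<^sup>2)\<^sup>2 = N * N ^ 3" by (simp add: power2_eq_square power3_eq_cube)
  finally have lt: "cnorm e < N * N ^ 3" .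
  have "e = (x - q * y) * yc"
    unfolding e_def z_def using yyc by (simp add: algebra_simps)
  then have "cnorm e = cnorm (x - q * y) * N ^ 3" by (simp add: cnorm_mult ncN)
  with lt have "cnorm (x - q * y) * N ^ 3 < N * N ^ 3" by simp
  then have "cnorm (x - q * y) < N"
    by (rule mult_right_less_imp_less) (use N0 in simp)
  then show ?thesis unfolding N_def by blast
qed

section \<open>Splitting of primes congruent to 1 modulo 12\<close>

text \<open>The reduction \<open>\<zeta> \<mapsto> c\<close>: for a root \<open>c\<close> of the twelfth cyclotomic polynomial modulo \<open>p\<close> one has
\<open>c\<^sup>1\<^sup>0 = 1 - c\<^sup>2\<close> and \<open>c\<^sup>5 = c\<^sup>3 - c\<close>.\<close>
definition phi :: "int \<Rightarrow> cyc \<Rightarrow> int" where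
  "phi c x = vx x * (1 - c\<^sup>2) + vy x * c + wx x * c\<^sup>2 + wy x * (c ^ 3 - c)"

lemma phi_diff: "phi c (x - y) = phi c x - phi c y"
  by (simp add: phi_def algebra_simps)

text \<open>Multiplicativity modulo \<open>p\<close>, stated with the exact multiple of the cyclotomic polynomial by which it
fails over the integers.\<close>
lemma phi_mult_exact:
  "phi c x * phi c y = phi c (x * y) + (c ^ 4 - c\<^sup>2 + 1) *
     (vx x * vx y - (vx x * wx y + wx x * vx y) - c * (vx x * wy y + wy x * vx y)
      + (vy x * wy y + wy x * vy y) + wx x * wx y + c * (wx x * wy y + wy x * wx y)
      + (c\<^sup>2 - 1) * (wy x * wy y))"
  by (simp add: phi_def times_cyc_def eval_nat_numeral algebra_simps)

lemma phi_of_int: "phi c (of_int a) = a"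
  by (simp add: phi_def of_int_cyc algebra_simps)

lemma phi_1 [simp]: "phi c 1 = 1"
  using phi_of_int[of c 1] by simp

text \<open>A primitive root raised to the power \<open>(p - 1) / 12\<close> has order 12. It is a root of \<open>X\<^sup>6 + 1\<close>, which factors
as \<open>(X\<^sup>2 + 1) (X\<^sup>4 - X\<^sup>2 + 1)\<close>, and it is not a root of the first factor because its order does not divide 4.\<close>
lemma exists_primitive_12th_root:
  assumes "prime p" "p mod 12 = 1"
  shows "\<exists>c::int. int p dvd c ^ 4 - c\<^sup>2 + 1"
proof -
  obtain g where g: "residue_primroot p g" using prime_primitive_root_exists[OF prime_gt_1_nat[OF assms(1)] assms(1)] by blast
  then have ordg: "ord p g = p - 1" using assms(1) by (simp add: residue_primroot_def totient_prime)
  define d where "d = (p - 1) div 12"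
  have pd: "p - 1 = 12 * d" using assms(2) unfolding d_def by presburger
  have d0: "d > 0" using prime_gt_1_nat[OF assms(1)] pd by (intro gr0I) simp
  define c where "c = int (g ^ d)"
  have dv: "int p dvd c ^ j - 1 \<longleftrightarrow> 12 dvd j" for j
  proof -
    have "int p dvd c ^ j - 1 \<longleftrightarrow> [int (g ^ (d * j)) = int 1] (mod int p)"
      by (simp add: c_def cong_iff_dvd_diff power_mult)
    also have "\<dots> \<longleftrightarrow> [g ^ (d * j) = 1] (mod p)" by (simp only: cong_int_iff)
    also have "\<dots> \<longleftrightarrow> d * 12 dvd d * j" unfolding ord_divides ordg pd by (simp only: mult.commute)
    also have "\<dots> \<longleftrightarrow> 12 dvd j" using d0 by simp
    finally show ?thesis .
  qed
  have pp: "prime (int p)" using assms(1) by simp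
  have "c ^ 12 - 1 = (c ^ 6 - 1) * ((c\<^sup>2 + 1) * (c ^ 4 - c\<^sup>2 + 1))"
    by (simp add: eval_nat_numeral algebra_simps)
  moreover have "int p dvd c ^ 12 - 1" "\<not> int p dvd c ^ 6 - 1" by (simp_all add: dv)
  ultimately have "int p dvd (c\<^sup>2 + 1) * (c ^ 4 - c\<^sup>2 + 1)"
    using prime_dvd_mult_iff[OF pp, of "c ^ 6 - 1" "(c\<^sup>2 + 1) * (c ^ 4 - c\<^sup>2 + 1)"] by simp
  moreover have "\<not> int p dvd c\<^sup>2 + 1"
  proof
    assume "int p dvd c\<^sup>2 + 1"
    then have "int p dvd (c\<^sup>2 + 1) * (c\<^sup>2 - 1)" by (rule dvd_mult2)
    also have "(c\<^sup>2 + 1) * (c\<^sup>2 - 1) = c ^ 4 - 1" by (simp add: eval_nat_numeral algebra_simps)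
    finally show False by (simp add: dv)
  qed
  ultimately have "int p dvd c ^ 4 - c\<^sup>2 + 1" by (simp add: prime_dvd_mult_iff[OF pp])
  then show ?thesis by blast
qed

locale root_mod_prime =
  fixes p :: nat and c :: int
  assumes prime_p: "prime p" and p_neq: "p \<noteq> 2" "p \<noteq> 3" and root: "int p dvd c ^ 4 - c\<^sup>2 + 1"
begin

lemma prime_int: "prime (int p)" using prime_p by simp

lemma not_dvd_unit: "\<not> int p dvd 1" using prime_int not_prime_unit by blast

lemma phi_mult_cong: "int p dvd phi c (x * y) \<longleftrightarrow> int p dvd phi c x * phi c y"
  unfolding phi_mult_exact using root by (simp add: dvd_add_left_iff)

lemma phi_mult_iff: "int p dvd phi c (x * y) \<longleftrightarrow> int p dvd phi c x \<or> int p dvd phi c y"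
  unfolding phi_mult_cong using prime_int by (simp add: prime_dvd_mult_iff)

lemma phi_power': "\<not> int p dvd phi c x \<Longrightarrow> \<not> int p dvd phi c (x ^ n)"
  by (induction n) (auto simp: phi_mult_iff not_dvd_unit)

lemma phi_cnorm:
  "int p dvd cnorm x \<longleftrightarrow> int p dvd phi c x \<or> int p dvd phi c (g5 x) \<or> int p dvd phi c (g7 x) \<or> int p dvd phi c (g11 x)"
proof -
  have "int p dvd cnorm x \<longleftrightarrow> int p dvd phi c (x * g5 x * g7 x * g11 x)"
    by (simp add: cnorm_galois phi_of_int)
  then show ?thesis by (simp add: phi_mult_iff disj_assoc)
qed

lemma phi_unit: "cnorm u = 1 \<Longrightarrow> \<not> int p dvd phi c u"
  using phi_cnorm[of u] not_dvd_unit by auto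

lemma not_dvd_small: "\<not> int p dvd 2" "\<not> int p dvd 3"
  using primes_dvd_imp_eq[OF prime_int, of 2] primes_dvd_imp_eq[OF prime_int, of 3] p_neq by auto

lemma not_dvd_c: "\<not> int p dvd c"
proof
  assume "int p dvd c"
  then have "int p dvd (c ^ 4 - c\<^sup>2 + 1) - c * (c ^ 3 - c)" using root by (intro dvd_diff dvd_mult2)
  also have "(c ^ 4 - c\<^sup>2 + 1) - c * (c ^ 3 - c) = 1" by (simp add: eval_nat_numeral algebra_simps)
  finally show False using not_dvd_unit by blast
qed

text \<open>The four reductions \<open>\<zeta> \<mapsto> c\<^sup>a\<close> have different kernels, as \<open>\<zeta> - c\<close> lies in only one of them.\<close>
lemma phi_separates:
  "\<exists>z. int p dvd phi c z \<and> \<not> int p dvd phi c (g5 z) \<and> \<not> int p dvd phi c (g7 z) \<and> \<not> int p dvd phi c (g11 z)"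
proof -
  define z where "z = zt - of_int c"
  have "phi c z = 0" by (simp add: z_def phi_diff phi_of_int) (simp add: phi_def zt_def)
  moreover have "phi c (g7 z) = (- 2) * c"
    by (simp add: z_def phi_def zt_def of_int_cyc g7_def algebra_simps)
  moreover have "phi c (g5 z) = c * (c\<^sup>2 - 2)"
    by (simp add: z_def phi_def zt_def of_int_cyc g5_def eval_nat_numeral algebra_simps)
  moreover have "phi c (g11 z) = (- c) * c\<^sup>2"
    by (simp add: z_def phi_def zt_def of_int_cyc g11_def eval_nat_numeral algebra_simps)
  moreover have "\<not> int p dvd c\<^sup>2 - 2"
  proof
    assume "int p dvd c\<^sup>2 - 2"
    then have "int p dvd (c ^ 4 - c\<^sup>2 + 1) - (c\<^sup>2 - 2) * (c\<^sup>2 + 1)" using dvd_diff[OF root dvd_mult2] by blast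
    also have "\<dots> = 3" by (simp add: eval_nat_numeral algebra_simps)
    finally show False using not_dvd_small by blast
  qed
  ultimately show ?thesis
    using not_dvd_c not_dvd_small prime_int
    by (intro exI[of _ z]) (simp add: prime_dvd_mult_iff prime_dvd_power_iff)
qed

text \<open>Euclidean division makes the kernel of the reduction principal, generated by an element \<open>\<pi>\<close> of
least norm. The product \<open>\<psi>\<close> of the other conjugates of \<open>\<pi>\<close> is not in the kernel, by \<open>phi_separates\<close>. Writing
\<open>p = \<pi> \<beta>\<close> and \<open>N(\<pi>) = p t\<close> gives \<open>\<psi> = \<beta> t\<close>, so \<open>p\<close> does not divide \<open>t\<close>; but taking norms in \<open>p = \<pi> \<beta>\<close> shows that
\<open>t\<close> divides \<open>p\<^sup>3\<close>, and so \<open>t = 1\<close>.\<close>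
lemma exists_prime_element:
  "\<exists>\<pi>. cnorm \<pi> = int p \<and> (\<forall>x. \<pi> dvd x \<longleftrightarrow> int p dvd phi c x) \<and>
     \<not> int p dvd phi c (g5 \<pi>) \<and> \<not> int p dvd phi c (g7 \<pi>) \<and> \<not> int p dvd phi c (g11 \<pi>)"
proof -
  let ?I = "{x. x \<noteq> 0 \<and> int p dvd phi c x}"
  have pI: "of_int (int p) \<in> ?I" using prime_gt_0_nat[OF prime_p] cnorm_of_int[of "int p"] cnorm_0_iff[of "of_int (int p)"]
    by (auto simp: phi_of_int simp del: of_int_of_nat_eq)
  then obtain \<pi> where pi: "\<pi> \<in> ?I" and least: "\<And>y. y \<in> ?I \<Longrightarrow> nat (cnorm \<pi>) \<le> nat (cnorm y)"
    using arg_min_nat_lemma[of "\<lambda>x. x \<in> ?I" _ "\<lambda>x. nat (cnorm x)"] by blast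
  have dvd: "\<pi> dvd x" if "int p dvd phi c x" for x
  proof -
    obtain q where q: "cnorm (x - q * \<pi>) < cnorm \<pi>" using euclidean_division pi by blast
    have "int p dvd phi c (x - q * \<pi>)" using that pi by (simp add: phi_diff phi_mult_iff)
    with least[of "x - q * \<pi>"] have "x - q * \<pi> \<noteq> 0 \<Longrightarrow> nat (cnorm \<pi>) \<le> nat (cnorm (x - q * \<pi>))"
      by simp
    moreover have "nat (cnorm (x - q * \<pi>)) < nat (cnorm \<pi>)" using q cnorm_nonneg[of "x - q * \<pi>"] by simp
    ultimately have "x - q * \<pi> = 0" by linarith
    then show ?thesis by simp
  qed
  have dvd_iff: "\<pi> dvd x \<longleftrightarrow> int p dvd phi c x" for x
    using dvd pi by (auto elim!: dvdE simp: phi_mult_iff)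
  obtain z where z: "int p dvd phi c z" "\<not> int p dvd phi c (g5 z)" "\<not> int p dvd phi c (g7 z)" "\<not> int p dvd phi c (g11 z)"
    using phi_separates by blast
  obtain y where "z = \<pi> * y" using dvd[OF z(1)] by (rule dvdE)
  with z have conj: "\<not> int p dvd phi c (g5 \<pi>)" "\<not> int p dvd phi c (g7 \<pi>)" "\<not> int p dvd phi c (g11 \<pi>)"
    by (auto simp: phi_mult_iff)
  define \<psi> where "\<psi> = g5 \<pi> * g7 \<pi> * g11 \<pi>"
  have psi: "\<not> int p dvd phi c \<psi>" using conj by (simp add: \<psi>_def phi_mult_iff)
  have norm: "\<pi> * \<psi> = of_int (cnorm \<pi>)" using cnorm_galois[of \<pi>] by (simp add: \<psi>_def mult.assoc)
  have "\<pi> dvd of_int (int p)" using dvd pI by blast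
  then obtain \<beta> where b: "of_int (int p) = \<pi> * \<beta>" by (rule dvdE)
  have "int p dvd cnorm \<pi>" using pi by (simp add: phi_cnorm)
  then obtain t where t: "cnorm \<pi> = int p * t" by (auto elim!: dvdE)
  have "\<pi> * \<psi> = \<pi> * (\<beta> * of_int t)" unfolding norm t of_int_mult b by (simp add: mult_ac)
  then have "\<psi> = \<beta> * of_int t" using pi by simp
  then have nt: "\<not> int p dvd t" using psi by (simp add: phi_mult_iff phi_of_int)
  have "int p ^ 4 = int p * t * cnorm \<beta>" using arg_cong[OF b, of cnorm] by (simp only: cnorm_of_int cnorm_mult t)
  then have "int p ^ 3 = t * cnorm \<beta>" using prime_gt_0_nat[OF prime_p] by (simp add: eval_nat_numeral)
  then have "t dvd int p ^ 3" by simp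
  moreover have "coprime t (int p ^ 3)"
    using prime_imp_coprime[OF prime_int nt] by (simp add: coprime_commute)
  ultimately have "is_unit t" by (meson coprime_common_divisor dvd_refl)
  moreover have "t \<ge> 0" using t cnorm_nonneg[of \<pi>] prime_gt_0_nat[OF prime_p] by (simp add: zero_le_mult_iff)
  ultimately have "t = 1" by simp
  then show ?thesis using t dvd_iff conj by auto
qed

end

locale split_prime = root_mod_prime +
  fixes \<pi> :: cyc
  assumes norm_pi: "cnorm \<pi> = int p" and pi_dvd_iff: "\<pi> dvd x \<longleftrightarrow> int p dvd phi c x"
    and conj_pi: "\<not> int p dvd phi c (g5 \<pi>)" "\<not> int p dvd phi c (g7 \<pi>)" "\<not> int p dvd phi c (g11 \<pi>)"

lemma split_prime_exists:
  assumes "prime p" "p mod 12 = 1"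
  shows "\<exists>c \<pi>. split_prime p c \<pi>"
proof -
  obtain c :: int where "int p dvd c ^ 4 - c\<^sup>2 + 1" using exists_primitive_12th_root[OF assms] by blast
  moreover have "p \<noteq> 2" "p \<noteq> 3" using assms(2) by auto
  ultimately interpret root_mod_prime p c
    using assms(1) by unfold_locales
  obtain \<pi> where "cnorm \<pi> = int p \<and> (\<forall>x. \<pi> dvd x \<longleftrightarrow> int p dvd phi c x) \<and>
     \<not> int p dvd phi c (g5 \<pi>) \<and> \<not> int p dvd phi c (g7 \<pi>) \<and> \<not> int p dvd phi c (g11 \<pi>)"
    using exists_prime_element by blast
  then have "split_prime p c \<pi>" by unfold_locales blast+
  then show ?thesis by blast
qed

section \<open>Factorization of the elements of prime power norm\<close>

type_synonym expo = "nat \<times> nat \<times> nat \<times> nat"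

fun exp_sum :: "expo \<Rightarrow> nat" where "exp_sum (a, b, c, d) = a + b + c + d"
text \<open>The place permutations by which \<open>g5\<close>, \<open>g7\<close> and \<open>g11\<close> act on exponent vectors
(\<open>prod_pi_galois\<close>).\<close>
fun h5 :: "expo \<Rightarrow> expo" where "h5 (a, b, c, d) = (b, a, d, c)"
fun h7 :: "expo \<Rightarrow> expo" where "h7 (a, b, c, d) = (c, d, a, b)"
fun h11 :: "expo \<Rightarrow> expo" where "h11 (a, b, c, d) = (d, c, b, a)"

lemma exp_sum_galois [simp]: "exp_sum (h5 q) = exp_sum q" "exp_sum (h7 q) = exp_sum q" "exp_sum (h11 q) = exp_sum q"
proof -
  obtain i j k l where "q = (i, j, k, l)" by (metis prod_cases4)
  then show "exp_sum (h5 q) = exp_sum q" "exp_sum (h7 q) = exp_sum q" "exp_sum (h11 q) = exp_sum q"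
    by simp_all
qed

context split_prime
begin

fun prod_pi :: "expo \<Rightarrow> cyc" where
  "prod_pi (i, j, k, l) = \<pi> ^ i * g5 \<pi> ^ j * g7 \<pi> ^ k * g11 \<pi> ^ l"

lemma prod_pi_galois: "g5 (prod_pi q) = prod_pi (h5 q)" "g7 (prod_pi q) = prod_pi (h7 q)" "g11 (prod_pi q) = prod_pi (h11 q)"
proof -
  obtain i j k l where "q = (i, j, k, l)" by (metis prod_cases4)
  then show "g5 (prod_pi q) = prod_pi (h5 q)" "g7 (prod_pi q) = prod_pi (h7 q)" "g11 (prod_pi q) = prod_pi (h11 q)"
    by (simp_all only: prod_pi.simps h5.simps h7.simps h11.simps galois_mult galois_power galois_comp mult_ac)
qed

lemma cnorm_prod_pi: "cnorm (prod_pi q) = int p ^ exp_sum q"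
proof -
  obtain i j k l where "q = (i, j, k, l)" by (metis prod_cases4)
  then show ?thesis
    by (simp only: prod_pi.simps exp_sum.simps cnorm_mult cnorm_power galois_cnorm norm_pi power_add)
qed

lemma pi_nonzero: "\<pi> \<noteq> 0"
  using norm_pi prime_gt_0_nat[OF prime_p] cnorm_0_iff[of \<pi>] by linarith

text \<open>If \<open>p\<close> divides the norm of \<open>x\<close>, then one of the four conjugates of \<open>x\<close> reduces to 0 and is
divisible by \<open>\<pi>\<close>; equivalently, \<open>x\<close> is divisible by a conjugate of \<open>\<pi>\<close>.\<close>
lemma factorization: "cnorm x = int p ^ n \<Longrightarrow> \<exists>u q. cnorm u = 1 \<and> exp_sum q = n \<and> x = u * prod_pi q"
proof (induction n arbitrary: x)
  case 0
  then show ?case by (intro exI[of _ x] exI[of _ "(0, 0, 0, 0)"]) simp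
next
  case (Suc n)
  have step: "\<exists>y. z = \<pi> * y \<and> cnorm y = int p ^ n" if "int p dvd phi c z" "cnorm z = cnorm x" for z
  proof -
    have "\<pi> dvd z" using that(1) pi_dvd_iff[of z] by simp
    then obtain y where y: "z = \<pi> * y" by (rule dvdE)
    have "int p * cnorm y = int p * int p ^ n" using that(2) Suc.prems by (simp add: y cnorm_mult norm_pi)
    then show ?thesis using y prime_gt_0_nat[OF prime_p] by auto
  qed
  have claim: "\<exists>u q. cnorm u = 1 \<and> exp_sum q = Suc n \<and> z = u * prod_pi q"
    if asm: "int p dvd phi c z" "cnorm z = cnorm x" for z
  proof -
    obtain y where y: "z = \<pi> * y" "cnorm y = int p ^ n" using step[OF asm] by blast
    obtain u q where uq: "cnorm u = 1" "exp_sum q = n" "y = u * prod_pi q" using Suc.IH[OF y(2)] by blast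
    obtain i j k l where q: "q = (i, j, k, l)" by (metis prod_cases4)
    have "z = u * prod_pi (Suc i, j, k, l)" using y(1) uq(3) by (simp add: q mult_ac)
    moreover have "exp_sum (Suc i, j, k, l) = Suc n" using uq(2) by (simp add: q)
    ultimately show ?thesis using uq(1) by blast
  qed
  have "int p dvd cnorm x" by (simp add: Suc.prems)
  then consider "int p dvd phi c x" | "int p dvd phi c (g5 x)" | "int p dvd phi c (g7 x)" | "int p dvd phi c (g11 x)"
    using phi_cnorm by blast
  then show ?case
  proof cases
    case 1
    from claim[OF this refl] show ?thesis by blast
  next
    case 2
    from claim[OF this galois_cnorm(1)] obtain u q
      where uq: "cnorm u = 1" "exp_sum q = Suc n" "g5 x = u * prod_pi q" by blast
    have "x = g5 u * prod_pi (h5 q)" using arg_cong[OF uq(3), of g5] by (simp add: prod_pi_galois)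
    then show ?thesis using uq by (intro exI[of _ "g5 u"] exI[of _ "h5 q"]) (simp add: exp_sum_galois)
  next
    case 3
    from claim[OF this galois_cnorm(2)] obtain u q
      where uq: "cnorm u = 1" "exp_sum q = Suc n" "g7 x = u * prod_pi q" by blast
    have "x = g7 u * prod_pi (h7 q)" using arg_cong[OF uq(3), of g7] by (simp add: prod_pi_galois)
    then show ?thesis using uq by (intro exI[of _ "g7 u"] exI[of _ "h7 q"]) (simp add: exp_sum_galois)
  next
    case 4
    from claim[OF this galois_cnorm(3)] obtain u q
      where uq: "cnorm u = 1" "exp_sum q = Suc n" "g11 x = u * prod_pi q" by blast
    have "x = g11 u * prod_pi (h11 q)" using arg_cong[OF uq(3), of g11] by (simp add: prod_pi_galois)
    then show ?thesis using uq by (intro exI[of _ "g11 u"] exI[of _ "h11 q"]) (simp add: exp_sum_galois)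
  qed
qed

text \<open>After cancelling the common power of \<open>\<pi>\<close>, a left-over factor \<open>\<pi>\<close> would divide a product of a unit and
powers of the other conjugates, none of which reduces to 0.\<close>
lemma first_exponent_le:
  assumes "cnorm u = 1" "cnorm u' = 1" "u * prod_pi q = u' * prod_pi q'"
  shows "fst q' \<le> fst q"
proof (rule ccontr)
  obtain a b d e a' b' d' e' where q: "q = (a, b, d, e)" "q' = (a', b', d', e')" by (metis prod_cases4)
  assume "\<not> fst q' \<le> fst q"
  then obtain k where k: "a' = a + Suc k" using less_imp_Suc_add q by fastforce
  define y where "y = u * (g5 \<pi> ^ b * g7 \<pi> ^ d * g11 \<pi> ^ e)"
  define y' where "y' = u' * (g5 \<pi> ^ b' * g7 \<pi> ^ d' * g11 \<pi> ^ e')"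
  have "\<pi> ^ a * y = \<pi> ^ a * (\<pi> * (\<pi> ^ k * y'))"
    using assms(3) by (simp add: q k y_def y'_def power_add mult_ac)
  then have "\<pi> dvd y" using pi_nonzero by simp
  then have "int p dvd phi c y" by (simp add: pi_dvd_iff)
  then show False unfolding y_def phi_mult_iff using phi_unit[OF assms(1)] conj_pi phi_power' by blast
qed

text \<open>The Galois conjugates of the equation compare the other three exponents in the same way.\<close>
lemma exponents_unique:
  assumes "cnorm u = 1" "cnorm u' = 1" "u * prod_pi q = u' * prod_pi q'"
  shows "q = q'"
proof -
  have le: "fst q' \<le> fst q \<and> fst (h5 q') \<le> fst (h5 q) \<and> fst (h7 q') \<le> fst (h7 q) \<and> fst (h11 q') \<le> fst (h11 q)"
    if "cnorm u = 1" "cnorm u' = 1" "u * prod_pi q = u' * prod_pi q'" for u u' q q'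
    using first_exponent_le[OF that]
      first_exponent_le[of "g5 u" "g5 u'" "h5 q" "h5 q'"] arg_cong[OF that(3), of g5]
      first_exponent_le[of "g7 u" "g7 u'" "h7 q" "h7 q'"] arg_cong[OF that(3), of g7]
      first_exponent_le[of "g11 u" "g11 u'" "h11 q" "h11 q'"] arg_cong[OF that(3), of g11] that(1,2)
    by (simp add: prod_pi_galois)
  show ?thesis
    using le[OF assms] le[OF assms(2,1) assms(3)[symmetric]] by (cases q; cases q') auto
qed

end

section \<open>Area and congruence in terms of relative norms\<close>

lemma area_tri: "area (tri x) = of_int \<bar>darea x\<bar> / 2"
proof -
  have "compact (convex hull (vertices (tri x)))"
    by (intro compact_convex_hull finite_imp_compact) (simp add: tri_def)
  then have "convex hull (vertices (tri x)) \<in> sets lborel"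
    by (simp add: borel_compact)
  then have "area (tri x) = measure lborel (convex hull (vertices (tri x)))"
    unfolding area_def by (rule measure_completion)
  also have "\<dots> = \<bar>of_int (wx x) * of_int (vy x) - of_int (vx x) * of_int (wy x)\<bar> / 2"
    by (simp add: tri_def content_triangle)
  also have "of_int (wx x) * of_int (vy x) - of_int (vx x) * of_int (wy x) = (of_int (- darea x) :: real)"
    by (simp add: darea_def)
  finally show ?thesis by simp
qed

definition pt :: "int \<Rightarrow> int \<Rightarrow> real ^ 2" where
  "pt a b = vector [of_int a, of_int b]"

lemma vertices_tri: "vertices (tri x) = {0, pt (vx x) (vy x), pt (wx x) (wy x)}"
  by (simp add: tri_def pt_def)

lemma pt_coords [simp]: "pt a b $ 1 = of_int a" "pt a b $ 2 = of_int b"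
  by (simp_all add: pt_def)

lemma dist_plane: "(dist x y)\<^sup>2 = (x $ 1 - y $ 1)\<^sup>2 + (x $ 2 - y $ 2)\<^sup>2" for x y :: "real ^ 2"
  by (simp add: dist_vec_def L2_set_def sum_2 dist_real_def)

lemma congruentI:
  assumes "\<And>x y :: real ^ 2. (dist (f x) (f y))\<^sup>2 = (dist x y)\<^sup>2" and "f ` vertices S = vertices T"
  shows "congruent S T"
proof -
  have "dist (f x) (f y) = dist x y" for x y
    by (rule power2_eq_imp_eq[OF assms(1)]) simp_all
  then show ?thesis unfolding congruent_def using assms(2) by blast
qed

lemma congruent_trans: "congruent S T \<Longrightarrow> congruent T U \<Longrightarrow> congruent S U"
  unfolding congruent_def
proof (elim exE conjE)
  fix f g :: "real ^ 2 \<Rightarrow> real ^ 2"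
  assume "\<forall>x y. dist (f x) (f y) = dist x y" "f ` vertices S = vertices T"
    "\<forall>x y. dist (g x) (g y) = dist x y" "g ` vertices T = vertices U"
  moreover from this have "(g \<circ> f) ` vertices S = vertices U" by (simp only: image_comp[symmetric])
  ultimately show "\<exists>f. (\<forall>x y. dist (f x) (f y) = dist x y) \<and> f ` vertices S = vertices U"
    by (intro exI[of _ "g \<circ> f"]) simp
qed

lemma congruent_refl: "congruent S S"
  unfolding congruent_def by (intro exI[of _ id]) simp

text \<open>The congruence is \<open>z \<mapsto> i (w - z)\<close>.\<close>
lemma congruent_zt: "congruent (tri x) (tri (zt * x))"
proof (rule congruentI)
  let ?f = "\<lambda>z :: real ^ 2. vector [z $ 2 - of_int (wy x), of_int (wx x) - z $ 1] :: real ^ 2"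
  show "(dist (?f a) (?f b))\<^sup>2 = (dist a b)\<^sup>2" for a b :: "real ^ 2"
    unfolding dist_plane by (simp add: power2_eq_square algebra_simps)
  have "?f 0 = pt (- wy x) (wx x)" "?f (pt (vx x) (vy x)) = pt (vy x - wy x) (wx x - vx x)" "?f (pt (wx x) (wy x)) = 0"
    by (simp_all add: vec_eq_iff forall_2)
  then show "?f ` vertices (tri x) = vertices (tri (zt * x))"
    by (simp only: vertices_tri zt_mult cyc.sel image_insert image_empty) auto
qed

lemma congruent_zt_power: "congruent (tri x) (tri (zt ^ n * x))"
proof (induction n)
  case 0
  show ?case by (simp add: congruent_refl)
next
  case (Suc n)
  have "zt ^ Suc n * x = zt * (zt ^ n * x)" by (simp add: mult_ac)
  then show ?case using congruent_trans[OF Suc congruent_zt] by (simp only:)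
qed

lemma congruent_g11: "congruent (tri x) (tri (g11 x))"
proof (rule congruentI)
  let ?f = "\<lambda>z :: real ^ 2. vector [z $ 1, - z $ 2] :: real ^ 2"
  show "(dist (?f a) (?f b))\<^sup>2 = (dist a b)\<^sup>2" for a b :: "real ^ 2"
    unfolding dist_plane by (simp add: power2_eq_square algebra_simps)
  have "?f 0 = 0" "?f (pt (vx x) (vy x)) = pt (vx x) (- vy x)" "?f (pt (wx x) (wy x)) = pt (wx x) (- wy x)"
    by (simp_all add: vec_eq_iff forall_2)
  then show "?f ` vertices (tri x) = vertices (tri (g11 x))"
    by (simp only: vertices_tri g11_def cyc.sel image_insert image_empty) auto
qed

lemma rotation_congruent:
  assumes cs: "c\<^sup>2 + s\<^sup>2 = (1::real)"
    and v: "of_int (vx y) = c * of_int (vx x) - s * of_int (vy x)" "of_int (vy y) = s * of_int (vx x) + c * of_int (vy x)"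
    and w: "of_int (wx y) = c * of_int (wx x) - s * of_int (wy x)" "of_int (wy y) = s * of_int (wx x) + c * of_int (wy x)"
  shows "congruent (tri x) (tri y)"
proof (rule congruentI)
  let ?f = "\<lambda>z :: real ^ 2. vector [c * z $ 1 - s * z $ 2, s * z $ 1 + c * z $ 2] :: real ^ 2"
  show "(dist (?f a) (?f b))\<^sup>2 = (dist a b)\<^sup>2" for a b :: "real ^ 2"
  proof -
    have "(dist (?f a) (?f b))\<^sup>2 = (c\<^sup>2 + s\<^sup>2) * ((a $ 1 - b $ 1)\<^sup>2 + (a $ 2 - b $ 2)\<^sup>2)"
      unfolding dist_plane by (simp add: power2_eq_square algebra_simps)
    then show ?thesis by (simp only: cs dist_plane mult_1)
  qed
  have "?f 0 = 0" "?f (pt (vx x) (vy x)) = pt (vx y) (vy y)" "?f (pt (wx x) (wy x)) = pt (wx y) (wy y)"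
    by (simp_all add: vec_eq_iff forall_2 v w)
  then show "?f ` vertices (tri x) = vertices (tri y)"
    by (simp only: vertices_tri image_insert image_empty)
qed

text \<open>In complex terms, with \<open>a + i b\<close> sent to \<open>a' + i b'\<close> of the same modulus, \<open>c + i s\<close> is their
quotient. If the pairs \<open>(a + i b, e + i f)\<close> and \<open>(a' + i b', e' + i f')\<close> have the same inner product and
determinant, the rotation by \<open>c + i s\<close> takes the second point along.\<close>
lemma turn_identities:
  fixes a b a' b' e f e' f' S :: real
  assumes "S \<noteq> 0" "S = a\<^sup>2 + b\<^sup>2" "S = a'\<^sup>2 + b'\<^sup>2"
    and "a * e + b * f = a' * e' + b' * f'" and "a * f - b * e = a' * f' - b' * e'"
  defines "c \<equiv> (a * a' + b * b') / S" and "s \<equiv> (a * b' - b * a') / S"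
  shows "c\<^sup>2 + s\<^sup>2 = 1" "a' = c * a - s * b" "b' = s * a + c * b" "e' = c * e - s * f" "f' = s * e + c * f"
proof -
  have "(a * a' + b * b')\<^sup>2 + (a * b' - b * a')\<^sup>2 = (a\<^sup>2 + b\<^sup>2) * (a'\<^sup>2 + b'\<^sup>2)"
    by (simp add: power2_eq_square algebra_simps)
  then have "(a * a' + b * b')\<^sup>2 + (a * b' - b * a')\<^sup>2 = S * S" using assms(2,3) by simp
  then show "c\<^sup>2 + s\<^sup>2 = 1" using assms(1)
    by (simp add: c_def s_def power_divide power2_eq_square flip: add_divide_distrib)
  have "(a * a' + b * b') * a - (a * b' - b * a') * b = S * a'"
    unfolding assms(2) by (simp add: power2_eq_square algebra_simps)
  then have "c * a - s * b = S * a' / S"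
    by (simp add: c_def s_def flip: add_divide_distrib diff_divide_distrib)
  then show "a' = c * a - s * b" using assms(1) by simp
  have "(a * b' - b * a') * a + (a * a' + b * b') * b = S * b'"
    unfolding assms(2) by (simp add: power2_eq_square algebra_simps)
  then have "s * a + c * b = S * b' / S"
    by (simp add: c_def s_def flip: add_divide_distrib diff_divide_distrib)
  then show "b' = s * a + c * b" using assms(1) by simp
  have "(a * a' + b * b') * e - (a * b' - b * a') * f = a' * (a * e + b * f) - b' * (a * f - b * e)"
    by (simp add: algebra_simps)
  also have "\<dots> = S * e'" unfolding assms(3,4,5) by (simp add: power2_eq_square algebra_simps)
  finally have "c * e - s * f = S * e' / S"
    by (simp add: c_def s_def flip: add_divide_distrib diff_divide_distrib)
  then show "e' = c * e - s * f" using assms(1) by simp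
  have "(a * b' - b * a') * e + (a * a' + b * b') * f = b' * (a * e + b * f) + a' * (a * f - b * e)"
    by (simp add: algebra_simps)
  also have "\<dots> = S * f'" unfolding assms(3,4,5) by (simp add: power2_eq_square algebra_simps)
  finally have "s * e + c * f = S * f' / S"
    by (simp add: c_def s_def flip: add_divide_distrib diff_divide_distrib)
  then show "f' = s * e + c * f" using assms(1) by simp
qed

text \<open>Equal signed areas make the congruence a rotation about the origin. It is determined by one of
the two vertices \<open>v, w\<close> that is nonzero, and since degenerate triangles are allowed, this need not be
\<open>v\<close>.\<close>
lemma side_side_side:
  assumes "x \<noteq> 0" "side1 x = side1 y" "side2 x = side2 y" "side3 x = side3 y" "darea x = darea y"
  shows "congruent (tri x) (tri y)"
proof -
  have i2: "vx z * wx z + vy z * wy z = (side1 z + side2 z - side3 z) div 2" for z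
  proof -
    have "side1 z + side2 z - side3 z = 2 * (vx z * wx z + vy z * wy z)"
      by (simp add: side_defs power2_eq_square algebra_simps)
    then show ?thesis by simp
  qed
  have "vx x * wx x + vy x * wy x = vx y * wx y + vy y * wy y"
    unfolding i2 assms(2-4) ..
  then have ip: "(of_int (vx x) * of_int (wx x) + of_int (vy x) * of_int (wy x) :: real)
      = of_int (vx y) * of_int (wx y) + of_int (vy y) * of_int (wy y)"
    by (metis of_int_add of_int_mult)
  have cr: "(of_int (vx x) * of_int (wy x) - of_int (vy x) * of_int (wx x) :: real)
      = of_int (vx y) * of_int (wy y) - of_int (vy y) * of_int (wx y)"
    using assms(5) unfolding darea_def by (metis of_int_diff of_int_mult)
  have sq: "(of_int (side1 z) :: real) = (of_int (vx z))\<^sup>2 + (of_int (vy z))\<^sup>2"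
    "(of_int (side2 z) :: real) = (of_int (wx z))\<^sup>2 + (of_int (wy z))\<^sup>2" for z
    by (simp_all add: side1_def side2_def)
  note s1 = sq(1)[of x] sq(1)[of y, folded assms(2)]
  note s2 = sq(2)[of x] sq(2)[of y, folded assms(3)]
  show ?thesis
  proof (cases "side1 x = 0")
    case False
    then have "(of_int (side1 x) :: real) \<noteq> 0" by simp
    note t = turn_identities[OF this s1 ip cr]
    show ?thesis by (rule rotation_congruent[OF t])
  next
    case True
    then have "vx x = 0" "vy x = 0" by (simp_all add: side1_def add_nonneg_eq_0_iff)
    with assms(1) have "side2 x \<noteq> 0" by (auto simp: side2_def cyc_eq_iff add_nonneg_eq_0_iff)
    then have n: "(of_int (side2 x) :: real) \<noteq> 0" by simp
    have ip': "(of_int (wx x) * of_int (vx x) + of_int (wy x) * of_int (vy x) :: real)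
      = of_int (wx y) * of_int (vx y) + of_int (wy y) * of_int (vy y)" using ip by (simp add: mult.commute)
    have cr': "(of_int (wx x) * of_int (vy x) - of_int (wy x) * of_int (vx x) :: real)
      = of_int (wx y) * of_int (vy y) - of_int (wy y) * of_int (vx y)" using cr by (simp add: algebra_simps)
    note t = turn_identities[OF n s2 ip' cr']
    show ?thesis by (rule rotation_congruent[OF t(1,4,5,2,3)])
  qed
qed

definition perm3 :: "'a \<Rightarrow> 'a \<Rightarrow> 'a \<Rightarrow> 'a \<Rightarrow> 'a \<Rightarrow> 'a \<Rightarrow> bool" where
  "perm3 a b c a' b' c' \<longleftrightarrow> (a', b', c') \<in> {(a, b, c), (a, c, b), (b, a, c), (b, c, a), (c, a, b), (c, b, a)}"

text \<open>The vertices of a degenerate triangle may coincide, and then the vertex set forgets which of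
them does. The side lengths are \<open>0, d, d\<close> in any case.\<close>
lemma perm3_distances_degenerate:
  fixes a c :: "'a :: metric_space"
  assumes "{a, c} = {a', b', c'}"
  shows "perm3 0 (dist a c) (dist a c) (dist a' b') (dist a' c') (dist b' c')"
proof -
  have m: "a' = a \<or> a' = c" "b' = a \<or> b' = c" "c' = a \<or> c' = c" using assms by blast+
  have n: "\<not> (a' = a \<and> b' = a \<and> c' = a)" "\<not> (a' = c \<and> b' = c \<and> c' = c)" if "a \<noteq> c"
    using assms that by auto
  show ?thesis
  proof (cases "a = c")
    case True
    then show ?thesis using m by (simp add: perm3_def)
  next
    case False
    note n = n[OF this]
    show ?thesis using m
    proof (elim disjE)
    qed (use n in \<open>simp_all add: perm3_def dist_commute\<close>)
  qed
qed

lemma perm3_distances: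
  fixes a b c :: "'a :: metric_space"
  assumes "{a, b, c} = {a', b', c'}"
  shows "perm3 (dist a b) (dist a c) (dist b c) (dist a' b') (dist a' c') (dist b' c')"
proof -
  have m: "a = a' \<or> a = b' \<or> a = c'" "b = a' \<or> b = b' \<or> b = c'" "c = a' \<or> c = b' \<or> c = c'" using assms by blast+
  consider "a = b" | "a = c" | "b = c" | "a \<noteq> b" "a \<noteq> c" "b \<noteq> c" by blast
  then show ?thesis
  proof cases
    case 1
    then have "{a, c} = {a', b', c'}" using assms by blast
    from perm3_distances_degenerate[OF this] show ?thesis using 1 by simp
  next
    case 2
    then have "{a, b} = {a', b', c'}" using assms by blast
    from perm3_distances_degenerate[OF this] have "perm3 (dist a b) 0 (dist a b) (dist a' b') (dist a' c') (dist b' c')"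
      unfolding perm3_def by blast
    then show ?thesis using 2 by (simp add: dist_commute)
  next
    case 3
    then have "{a, b} = {a', b', c'}" using assms by blast
    from perm3_distances_degenerate[OF this] have "perm3 (dist a b) (dist a b) 0 (dist a' b') (dist a' c') (dist b' c')"
      unfolding perm3_def by blast
    then show ?thesis using 3 by simp
  next
    case 4
    show ?thesis using m
    proof (elim disjE)
    qed (use 4 in \<open>simp_all add: perm3_def dist_commute\<close>)
  qed
qed

lemma perm3_inj: "perm3 (f a) (f b) (f c) (f a') (f b') (f c') \<Longrightarrow> inj f \<Longrightarrow> perm3 a b c a' b' c'"
  by (auto simp: perm3_def inj_eq)

lemma perm3_map: "perm3 a b c a' b' c' \<Longrightarrow> perm3 (f a) (f b) (f c) (f a') (f b') (f c')"
  by (auto simp: perm3_def)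

lemma congruent_sides:
  assumes "congruent (tri x) (tri y)"
  shows "perm3 (side1 x) (side2 x) (side3 x) (side1 y) (side2 y) (side3 y)"
proof -
  obtain f where iso: "\<And>a b. dist (f a) (f b) = dist a b" and im: "f ` vertices (tri x) = vertices (tri y)"
    using assms unfolding congruent_def by blast
  let ?v = "pt (vx x) (vy x)" and ?w = "pt (wx x) (wy x)" and ?v' = "pt (vx y) (vy y)" and ?w' = "pt (wx y) (wy y)"
  have "{f 0, f ?v, f ?w} = {0, ?v', ?w'}" using im unfolding vertices_tri by simp
  from perm3_distances[OF this]
  have "perm3 (dist 0 ?v) (dist 0 ?w) (dist ?v ?w) (dist 0 ?v') (dist 0 ?w') (dist ?v' ?w')"
    by (simp only: iso)
  then have "perm3 ((dist 0 ?v)\<^sup>2) ((dist 0 ?w)\<^sup>2) ((dist ?v ?w)\<^sup>2) ((dist 0 ?v')\<^sup>2) ((dist 0 ?w')\<^sup>2) ((dist ?v' ?w')\<^sup>2)"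
    by (rule perm3_map)
  then have "perm3 (real_of_int (side1 x)) (of_int (side2 x)) (of_int (side3 x)) (of_int (side1 y)) (of_int (side2 y)) (of_int (side3 y))"
    unfolding dist_plane by (simp add: side_defs)
  then show ?thesis by (rule perm3_inj) (simp add: inj_def)
qed

text \<open>The norm to the Eisenstein integers.\<close>
definition eis_norm :: "cyc \<Rightarrow> cyc" where "eis_norm x = x * g7 x"

lemma eis_norm_sides: "eis_norm x = Cyc (side1 x - side3 x) 0 (side2 x - side3 x) 0"
  unfolding eis_norm_def by (rule rel_norm_sqrtm3)

lemma eis_norm_mult: "eis_norm (x * y) = eis_norm x * eis_norm y"
  by (simp add: eis_norm_def mult_ac)

lemma g7_eis_norm: "g7 (eis_norm x) = eis_norm x" by (simp add: eis_norm_def mult.commute)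
lemma g5_eis_norm: "g5 (eis_norm x) = eis_norm (g11 x)" by (simp add: eis_norm_def mult.commute)

text \<open>Of the six permutations of the side lengths, the cyclic ones multiply the norm by a cube root of
unity, and a transposition conjugates it. The two nontrivial cube roots of unity are \<open>u1\<close> and \<open>u2\<close>.\<close>
lemma congruent_eis_norm:
  assumes "congruent (tri x) (tri y)"
  shows "\<exists>u. cnorm u = 1 \<and> (eis_norm y = u * eis_norm x \<or> eis_norm y = u * g5 (eis_norm x))"
proof -
  define u1 where "u1 = Cyc 0 0 (-1) 0"
  define u2 where "u2 = Cyc (-1) 0 0 0"
  have n: "cnorm u1 = 1" "cnorm u2 = 1" by (simp_all add: u1_def u2_def cnorm_def qform_def darea_def)
  have "\<exists>u\<in>{1, u1, u2}. eis_norm y = u * eis_norm x \<or> eis_norm y = u * g5 (eis_norm x)"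
    using congruent_sides[OF assms] unfolding perm3_def eis_norm_sides
    by (elim insertE emptyE) (simp_all add: u1_def u2_def times_cyc_def g5_def)
  then show ?thesis using n cnorm_1 by blast
qed

lemma zt_eis: "zt ^ 2 * Cyc a 0 b 0 = Cyc (a - b) 0 a 0"
  by (simp add: zt_powers times_cyc_def)

text \<open>The prime over 3 in the Eisenstein integers has residue field of order 3; up to sign, the
reduction is the sum of the two coordinates, and \<open>\<zeta>\<^sup>2\<close>, a primitive sixth root of unity, reduces to -1.\<close>
lemma zt_even_power_sum_mod3:
  "\<exists>a' b'. zt ^ (2 * i) * Cyc a 0 b 0 = Cyc a' 0 b' 0 \<and> [a' + b' = (-1) ^ i * (a + b)] (mod 3)"
proof (induction i)
  case 0
  show ?case by (intro exI[of _ a] exI[of _ b]) simp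
next
  case (Suc i)
  then obtain a' b' where IH: "zt ^ (2 * i) * Cyc a 0 b 0 = Cyc a' 0 b' 0" "[a' + b' = (-1) ^ i * (a + b)] (mod 3)" by blast
  have "zt ^ (2 * Suc i) * Cyc a 0 b 0 = zt ^ 2 * (zt ^ (2 * i) * Cyc a 0 b 0)"
    by (simp add: power_add mult_ac power2_eq_square)
  also have "\<dots> = Cyc (a' - b') 0 a' 0" by (simp only: IH zt_eis)
  finally have 1: "zt ^ (2 * Suc i) * Cyc a 0 b 0 = Cyc (a' - b') 0 a' 0" .
  have "[(a' - b') + a' = - (a' + b')] (mod 3)"
    by (simp add: cong_iff_dvd_diff)
  also have "[- (a' + b') = - ((-1) ^ i * (a + b))] (mod 3)" using IH(2) by (simp only: cong_minus_minus_iff)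
  finally show ?case using 1 by (intro exI[of _ "a' - b'"] exI[of _ a']) simp
qed

lemma eisenstein_unit:
  assumes "cnorm u = 1" "g7 u = u"
  shows "\<exists>i. u = zt ^ (2 * i)"
proof -
  have u: "u = Cyc (vx u) 0 (wx u) 0" using assms(2) by (simp add: g7_def cyc_eq_iff)
  let ?Q = "(vx u)\<^sup>2 + (wx u)\<^sup>2 - vx u * wx u"
  have "cnorm u = ?Q\<^sup>2" by (subst u) (simp add: cnorm_def qform_def darea_def)
  with assms(1) have "?Q = 1" using hex_nonneg[of "vx u" "wx u"] by (simp add: power2_eq_1_iff)
  from hex_unit[OF this] show ?thesis using u by (simp only: u[symmetric])
qed

text \<open>The unit \<open>u\<close> is a sixth root of unity. Both norms reduce to the same nonzero residue modulo the prime
over 3, namely \<open>2 * qform x\<close> in the normalization above, so \<open>u\<close> is even a cube root of unity. Such a factor is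
removed by rotating the labelling of the vertices of \<open>x\<close>, that is, by multiplying \<open>x\<close> with a power of
\<open>\<zeta>\<close>; the side lengths then agree.\<close>
lemma eis_norm_associated_congruent:
  assumes "x \<noteq> 0" "qform x = qform y" "darea x = darea y" "\<not> 3 dvd qform x"
    and u: "cnorm u = 1" "eis_norm y = u * eis_norm x"
  shows "congruent (tri x) (tri y)"
proof -
  have "cnorm (eis_norm x) \<noteq> 0"
    using assms(1) by (simp add: eis_norm_def cnorm_mult cnorm_0_iff)
  then have nz: "eis_norm x \<noteq> 0" by (simp add: cnorm_0_iff)
  have "g7 u * eis_norm x = u * eis_norm x"
    using g7_eis_norm[of y] unfolding u(2) galois_mult g7_eis_norm .
  then have "g7 u = u" using nz by simp
  then obtain i where i: "u = zt ^ (2 * i)" using eisenstein_unit u(1) by blast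
  obtain a b where ab: "zt ^ (2 * i) * eis_norm x = Cyc a 0 b 0"
     "[a + b = (-1) ^ i * (side1 x - side3 x + (side2 x - side3 x))] (mod 3)"
    using zt_even_power_sum_mod3[of i "side1 x - side3 x" "side2 x - side3 x"] unfolding eis_norm_sides by blast
  have s: "[side1 z - side3 z + (side2 z - side3 z) = 2 * qform z] (mod 3)" for z
    using qform_sides[of z] by (simp add: cong_iff_dvd_diff)
  have e: "even i"
  proof (rule ccontr)
    assume "odd i"
    have "a + b = side1 y - side3 y + (side2 y - side3 y)"
      using u(2) ab(1) unfolding i eis_norm_sides by simp
    with s[of y] have "[2 * qform y = a + b] (mod 3)" by (simp add: cong_sym)
    also note ab(2)
    also have "[(-1) ^ i * (side1 x - side3 x + (side2 x - side3 x)) = (-1) ^ i * (2 * qform x)] (mod 3)"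
      by (intro cong_scalar_left s)
    finally have "[2 * qform x = - (2 * qform x)] (mod 3)" using \<open>odd i\<close> assms(2) by simp
    then have "3 dvd 4 * qform x" by (simp add: cong_iff_dvd_diff)
    then show False using assms(4) by presburger
  qed
  then obtain j where j: "i = 2 * j" by blast
  define z where "z = zt ^ (2 * j) * x"
  have "zt ^ 8 = zt ^ 6 * zt ^ 2" by (simp flip: power_add)
  also have "\<dots> = Cyc 0 0 (-1) 0" unfolding zt_powers by (simp add: cyc_eq_iff)
  also have "\<dots> = zt * g7 zt" unfolding zt_mult by (simp add: zt_def g7_def)
  finally have zz: "zt * g7 zt = zt ^ 8" by (rule sym)
  have "eis_norm (zt ^ (2 * j)) = (zt * g7 zt) ^ (2 * j)" by (simp add: eis_norm_def power_mult_distrib)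
  also have "\<dots> = zt ^ (12 * j + 4 * j)" by (simp add: zz flip: power_mult)
  also have "\<dots> = u" by (simp only: power_add power_mult[of zt 12] zt_12 i j) simp
  finally have ez: "eis_norm z = eis_norm y" by (simp add: z_def eis_norm_mult u(2))
  have qd: "qform (zt ^ n) = 1 \<and> darea (zt ^ n) = 0" for n
  proof (induction n)
    case (Suc n)
    then show ?case by (simp add: qform_mult darea_mult) (simp add: qform_def darea_def zt_def)
  qed (simp add: qform_def darea_def)
  then have qz: "qform z = qform x" "darea z = darea x" by (simp_all add: z_def qform_mult darea_mult)
  have "cnorm z \<noteq> 0" using assms(1) by (simp add: z_def cnorm_mult cnorm_power cnorm_zt cnorm_0_iff)
  then have z0: "z \<noteq> 0" by (simp add: cnorm_0_iff)
  have "side1 z = side1 y" "side2 z = side2 y" "side3 z = side3 y"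
    using ez qform_sides[of z] qform_sides[of y] qz(1) assms(2) unfolding eis_norm_sides by simp_all
  then have "congruent (tri z) (tri y)" using z0 qz(2) assms(3) by (intro side_side_side) simp_all
  then show ?thesis unfolding z_def by (rule congruent_trans[OF congruent_zt_power])
qed

lemma congruent_iff_eis_norm:
  assumes "x \<noteq> 0" "qform x = qform y" "darea x = darea y" "\<not> 3 dvd qform x"
  shows "congruent (tri x) (tri y) \<longleftrightarrow>
    (\<exists>u. cnorm u = 1 \<and> (eis_norm y = u * eis_norm x \<or> eis_norm y = u * g5 (eis_norm x)))"
proof
  assume "\<exists>u. cnorm u = 1 \<and> (eis_norm y = u * eis_norm x \<or> eis_norm y = u * g5 (eis_norm x))"
  then obtain u where u: "cnorm u = 1" "eis_norm y = u * eis_norm x \<or> eis_norm y = u * eis_norm (g11 x)"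
    unfolding g5_eis_norm by blast
  from u(2) show "congruent (tri x) (tri y)"
  proof
    assume "eis_norm y = u * eis_norm x"
    then show ?thesis by (rule eis_norm_associated_congruent[OF assms u(1)])
  next
    assume e: "eis_norm y = u * eis_norm (g11 x)"
    have "g11 x \<noteq> 0"
      using assms(1) cnorm_0_iff[of "g11 x"] unfolding galois_cnorm cnorm_0_iff by blast
    then have "congruent (tri (g11 x)) (tri y)"
      using assms by (intro eis_norm_associated_congruent[OF _ _ _ _ u(1) e]) simp_all
    then show ?thesis by (rule congruent_trans[OF congruent_g11])
  qed
qed (rule congruent_eis_norm)

section \<open>Orbits, leaders and labels\<close>

definition orb :: "expo \<Rightarrow> expo set" where "orb q = {q, h5 q, h7 q, h11 q}"

lemma h_comp [simp]:
  "h5 (h5 q) = q" "h7 (h7 q) = q" "h11 (h11 q) = q" "h5 (h7 q) = h11 q" "h7 (h5 q) = h11 q"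
  "h5 (h11 q) = h7 q" "h11 (h5 q) = h7 q" "h7 (h11 q) = h5 q" "h11 (h7 q) = h5 q"
proof -
  obtain i j k l where "q = (i, j, k, l)" by (metis prod_cases4)
  then show "h5 (h5 q) = q" "h7 (h7 q) = q" "h11 (h11 q) = q" "h5 (h7 q) = h11 q" "h7 (h5 q) = h11 q"
    "h5 (h11 q) = h7 q" "h11 (h5 q) = h7 q" "h7 (h11 q) = h5 q" "h11 (h7 q) = h5 q"
    by simp_all
qed

lemma orb_eq: "q' \<in> orb q \<Longrightarrow> orb q' = orb q"
  unfolding orb_def by (elim insertE emptyE) (simp_all add: insert_commute)

lemma orb_refl: "q \<in> orb q" by (simp add: orb_def)

lemma exp_sum_orb: "q' \<in> orb q \<Longrightarrow> exp_sum q' = exp_sum q"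
  by (auto simp: orb_def)

text \<open>The exponents of the norms to \<open>\<int>[sqrt 3]\<close> (class \<open>s\<close>) and to the Eisenstein integers (class
\<open>t\<close>), see \<open>real_norm_prod_pi\<close> and \<open>eis_norm_prod_pi\<close>. The minimum makes them invariant under the Galois
group, which can only exchange the two sums.\<close>
fun sclass :: "expo \<Rightarrow> nat" where "sclass (i, j, k, l) = min (i + l) (j + k)"
fun tclass :: "expo \<Rightarrow> nat" where "tclass (i, j, k, l) = min (i + k) (j + l)"

lemma class_orb: "q' \<in> orb q \<Longrightarrow> sclass q' = sclass q" "q' \<in> orb q \<Longrightarrow> tclass q' = tclass q"
proof -
  obtain i j k l where "q = (i, j, k, l)" by (metis prod_cases4)
  then show "q' \<in> orb q \<Longrightarrow> sclass q' = sclass q" "q' \<in> orb q \<Longrightarrow> tclass q' = tclass q"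
    unfolding orb_def by (auto simp: min.commute add.commute)
qed

lemma sides_zt: "side1 (zt * x) = side2 x" "side2 (zt * x) = side3 x" "side3 (zt * x) = side1 x"
  by (simp_all add: side_defs zt_mult power2_eq_square algebra_simps)

lemma sides_g11: "side1 (g11 x) = side2 x" "side2 (g11 x) = side1 x" "side3 (g11 x) = side3 x"
  by (simp_all add: side_defs g11_def power2_eq_square algebra_simps)

lemma darea_zt: "darea (zt * x) = darea x"
  by (simp add: darea_def zt_mult algebra_simps)

lemma leader_shape_tri: "leader_shape (tri x) \<longleftrightarrow>
   vx x \<ge> 0 \<and> vy x \<ge> 0 \<and> side1 x \<ge> side2 x \<and> side2 x \<ge> side3 x \<and> darea x \<ge> 0"
  by (simp add: tri_def side_defs darea_def)

text \<open>First the orientation is corrected by swapping the two vertices. Then \<open>\<zeta>\<close> permutes the three sides cyclically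
and \<open>g11\<close> transposes two of them without changing the signed area, so the sides can be sorted. Finally
multiplication by \<open>i = \<zeta>\<^sup>3\<close> turns the triangle by a right angle and brings the first vertex into the
first quadrant.\<close>
lemma leader_shape_reachable:
  assumes zt: "\<And>x. P x \<Longrightarrow> P (zt * x)" and g5: "\<And>x. P x \<Longrightarrow> P (g5 x)" and g11: "\<And>x. P x \<Longrightarrow> P (g11 x)"
    and "P x"
  shows "\<exists>y. P y \<and> \<bar>darea y\<bar> = \<bar>darea x\<bar> \<and> leader_shape (tri y)"
proof -
  obtain a where a: "P a" "darea a = \<bar>darea x\<bar>"
    using \<open>P x\<close> g5[OF \<open>P x\<close>] galois_darea(1)[of x] by (cases "darea x \<ge> 0") (auto simp: abs_if)
  obtain b where b: "P b" "darea b = \<bar>darea x\<bar>" "side1 b \<ge> side2 b" "side1 b \<ge> side3 b"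
  proof -
    consider "side1 a \<ge> side2 a \<and> side1 a \<ge> side3 a" | "side2 a \<ge> side1 a \<and> side2 a \<ge> side3 a"
      | "side3 a \<ge> side1 a \<and> side3 a \<ge> side2 a" by linarith
    then show thesis
    proof cases
      case 1
      then show thesis using that[of a] a by simp
    next
      case 2
      then show thesis using that[of "zt * a"] a zt by (simp add: sides_zt darea_zt)
    next
      case 3
      then show thesis using that[of "zt * (zt * a)"] a zt by (simp add: sides_zt darea_zt)
    qed
  qed
  obtain c where c: "P c" "darea c = \<bar>darea x\<bar>" "side1 c \<ge> side2 c" "side2 c \<ge> side3 c"
  proof (cases "side2 b \<ge> side3 b")
    case True
    then show thesis using that[of b] b by simp
  next
    case False
    then show thesis using that[of "zt * g11 b"] b zt g11 by (simp add: sides_zt sides_g11 darea_zt)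
  qed
  define r where "r y = zt * (zt * (zt * y))" for y
  have r: "vx (r y) = - vy y" "vy (r y) = vx y" "side1 (r y) = side1 y" "side2 (r y) = side2 y"
    "side3 (r y) = side3 y" "darea (r y) = darea y" for y
    by (simp_all only: r_def sides_zt darea_zt) (simp_all add: zt_mult)
  have Pr: "P y \<Longrightarrow> P (r y)" for y unfolding r_def by (intro zt)
  \<comment> \<open>Among the four quarter turns of a vector one lies in the closed first quadrant.\<close>
  have "\<exists>y\<in>{c, r c, r (r c), r (r (r c))}. vx y \<ge> 0 \<and> vy y \<ge> 0"
    by (simp add: r) linarith
  then obtain y where y: "y \<in> {c, r c, r (r c), r (r (r c))}" "vx y \<ge> 0" "vy y \<ge> 0" by blast
  have "P y \<and> darea y = darea c \<and> side1 y = side1 c \<and> side2 y = side2 c \<and> side3 y = side3 c"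
    using y(1) c(1) Pr by (auto simp: r)
  then show ?thesis using c y by (intro exI[of _ y]) (simp add: leader_shape_tri)
qed

text \<open>The norm to \<open>\<int>[sqrt 3]\<close>.\<close>
definition real_norm :: "cyc \<Rightarrow> cyc" where "real_norm x = x * g11 x"

lemma real_norm_eq_iff: "real_norm x = real_norm y \<longleftrightarrow> qform x = qform y \<and> darea x = darea y"
  unfolding real_norm_def rel_norm_sqrt3 by auto

lemma real_norm_mult: "real_norm (x * y) = real_norm x * real_norm y"
  by (simp add: real_norm_def mult_ac)

lemma qform_unique:
  assumes "cnorm x = cnorm y" "\<bar>darea x\<bar> = \<bar>darea y\<bar>"
  shows "qform x = qform y"
proof -
  have "(darea x)\<^sup>2 = (darea y)\<^sup>2" using assms(2) by (metis power2_abs)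
  then have "(qform x)\<^sup>2 = (qform y)\<^sup>2" using assms(1) unfolding cnorm_def by simp
  then show ?thesis using qform_nonneg power2_eq_imp_eq by blast
qed

lemma cnorm_real_norm: "cnorm (real_norm x) = (cnorm x)\<^sup>2"
  by (simp add: real_norm_def cnorm_mult power2_eq_square)
lemma cnorm_eis_norm: "cnorm (eis_norm x) = (cnorm x)\<^sup>2"
  by (simp add: eis_norm_def cnorm_mult power2_eq_square)

text \<open>At a given label and half, the leader of every coset is multiplied by one and the same unit.\<close>
definition label_unit :: "int \<Rightarrow> bool \<Rightarrow> cyc \<Rightarrow> bool" where
  "label_unit j h \<mu> \<longleftrightarrow> cnorm \<mu> = 1 \<and>
     (\<forall>C. labelled C j h = tri (\<mu> * cyc_of (leader C)))"

lemma label_unit_exists: "\<exists>\<mu>. label_unit j h \<mu>"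
proof -
  have e: "2 + of_real (sqrt 3) = cx (Cyc 2 1 2 (-1))" "cnorm (Cyc 2 1 2 (-1)) = 1"
    by (simp_all add: cx_complex complex_eq_iff cnorm_def qform_def darea_def)
  obtain x where x: "(2 + of_real (sqrt 3)) powi j = cx x" "cnorm x = 1"
    unfolding e(1) using unit_powi[OF e(2), of j] by blast
  define y where "y = (if h then Cyc 0 1 1 0 else 1)"
  have "zeta + zeta ^ 2 = cx (zt + zt ^ 2)" by (simp only: cx_add cx_power cx_zt)
  also have "zt + zt ^ 2 = Cyc 0 1 1 0" by (simp add: zt_powers cyc_eq_iff) (simp add: zt_def)
  finally have y: "(if h then zeta + zeta ^ 2 else 1) = cx y" by (simp add: y_def)
  have "cnorm y = 1" by (simp add: y_def cnorm_def qform_def darea_def)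
  moreover have "labelled C j h = tri ((x * y) * cyc_of (leader C))" for C
    unfolding labelled_def x y elt_cx[of "leader C"] by (simp only: cx_mult[symmetric] inv_elt_cx) (simp add: mult_ac)
  ultimately show ?thesis unfolding label_unit_def using x(2) by (intro exI[of _ "x * y"]) (simp add: cnorm_mult)
qed

lemma labelled_leader: "labelled C 0 False = leader C"
  unfolding labelled_def by (simp add: elt_cx[of "leader C"] inv_elt_cx)

context split_prime
begin

text \<open>The coset of solutions, Galois conjugates merged, that belongs to an exponent vector.\<close>
definition expo_coset :: "expo \<Rightarrow> triangle set" where
  "expo_coset q = {S. \<exists>u q'. cnorm u = 1 \<and> q' \<in> orb q \<and> cyc_of S = u * prod_pi q'}"

lemma expo_cosetI: "cnorm u = 1 \<Longrightarrow> q' \<in> orb q \<Longrightarrow> x = u * prod_pi q' \<Longrightarrow> tri x \<in> expo_coset q"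
  unfolding expo_coset_def mem_Collect_eq cyc_of_tri by blast

lemma prod_pi_mem_expo_coset: "tri (prod_pi q) \<in> expo_coset q"
  by (rule expo_cosetI[OF cnorm_1 orb_refl]) simp

lemma coset_eq_expo_coset:
  assumes u: "cnorm u = 1" and T: "cyc_of T = u * prod_pi q"
  shows "coset T = expo_coset q"
proof (rule Set.set_eqI)
  fix S
  have conj: "{cyc_of T, g5 (cyc_of T), g7 (cyc_of T), g11 (cyc_of T)} =
     {u * prod_pi q, g5 u * prod_pi (h5 q), g7 u * prod_pi (h7 q), g11 u * prod_pi (h11 q)}"
    by (simp add: T prod_pi_galois)
  have absorb: "(\<exists>v. cnorm v = 1 \<and> x = v * (w * y)) \<longleftrightarrow> (\<exists>v. cnorm v = 1 \<and> x = v * y)"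
    if w: "cnorm w = 1" for w x y
  proof
    assume "\<exists>v. cnorm v = 1 \<and> x = v * (w * y)"
    then obtain v where "cnorm v = 1" "x = v * (w * y)" by blast
    then show "\<exists>v. cnorm v = 1 \<and> x = v * y"
      by (intro exI[of _ "v * w"]) (simp add: cnorm_mult w mult.assoc)
  next
    assume "\<exists>v. cnorm v = 1 \<and> x = v * y"
    then obtain v where v: "cnorm v = 1" "x = v * y" by blast
    obtain w' where w': "cnorm w' = 1" "w * w' = 1" using unit_inverse[OF w] .
    have "x = (w * w') * (v * y)" using v w' by simp
    then show "\<exists>v. cnorm v = 1 \<and> x = v * (w * y)"
      using v w' by (intro exI[of _ "v * w'"]) (simp add: cnorm_mult mult_ac)
  qed
  have "S \<in> coset T \<longleftrightarrow>
      (\<exists>v. cnorm v = 1 \<and> cyc_of S = v * (u * prod_pi q)) \<or>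
      (\<exists>v. cnorm v = 1 \<and> cyc_of S = v * (g5 u * prod_pi (h5 q))) \<or>
      (\<exists>v. cnorm v = 1 \<and> cyc_of S = v * (g7 u * prod_pi (h7 q))) \<or>
      (\<exists>v. cnorm v = 1 \<and> cyc_of S = v * (g11 u * prod_pi (h11 q)))"
    unfolding coset_cyc conj by blast
  also have "\<dots> \<longleftrightarrow> S \<in> expo_coset q"
    unfolding expo_coset_def orb_def using u by (simp only: absorb galois_cnorm) blast
  finally show "S \<in> coset T \<longleftrightarrow> S \<in> expo_coset q" .
qed

text \<open>Unique factorization reduces the comparison of cosets to a finite combinatorial question.\<close>
lemma expo_coset_eq_iff: "expo_coset q = expo_coset q' \<longleftrightarrow> orb q = orb q'"
proof
  assume eq: "expo_coset q = expo_coset q'"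
  have "tri (prod_pi q) \<in> expo_coset q" by (rule prod_pi_mem_expo_coset)
  then obtain u q'' where "cnorm u = 1" "q'' \<in> orb q'" "1 * prod_pi q = u * prod_pi q''"
    unfolding eq by (auto simp: expo_coset_def)
  then show "orb q = orb q'" using exponents_unique[of 1 u q q''] orb_eq by auto
qed (simp add: expo_coset_def)

lemma solution_cosets_eq: "solution_cosets (p ^ n) = expo_coset ` {q. exp_sum q = n}"
proof -
  have iff: "norm12 T = of_nat (p ^ n) \<longleftrightarrow> cnorm (cyc_of T) = int p ^ n" for T
  proof -
    have "norm12 T = of_nat (p ^ n) \<longleftrightarrow> (of_int (cnorm (cyc_of T)) :: complex) = of_int (int p ^ n)"
      by (simp add: norm12_cnorm)
    then show ?thesis by (simp only: of_int_eq_iff)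
  qed
  show ?thesis
  proof (intro subset_antisym subsetI)
    fix C assume "C \<in> solution_cosets (p ^ n)"
    then obtain T where T: "C = coset T" "cnorm (cyc_of T) = int p ^ n"
      unfolding solution_cosets_def iff by blast
    then obtain u q where "cnorm u = 1" "exp_sum q = n" "cyc_of T = u * prod_pi q"
      using factorization by blast
    then show "C \<in> expo_coset ` {q. exp_sum q = n}" using T coset_eq_expo_coset by blast
  next
    fix C assume "C \<in> expo_coset ` {q. exp_sum q = n}"
    then obtain q where q: "C = expo_coset q" "exp_sum q = n" by blast
    have "C = coset (tri (prod_pi q))" using coset_eq_expo_coset[of 1 "tri (prod_pi q)" q] q by simp
    moreover have "cnorm (cyc_of (tri (prod_pi q))) = int p ^ n" by (simp add: cnorm_prod_pi q)
    ultimately show "C \<in> solution_cosets (p ^ n)" unfolding solution_cosets_def iff by blast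
  qed
qed

lemma expo_coset_closed:
  assumes "tri x \<in> expo_coset q"
  shows "tri (zt * x) \<in> expo_coset q" "tri (g5 x) \<in> expo_coset q" "tri (g11 x) \<in> expo_coset q"
proof -
  obtain u q' where u: "cnorm u = 1" "q' \<in> orb q" "x = u * prod_pi q'"
    using assms by (auto simp: expo_coset_def)
  have h: "h5 q' \<in> orb q" "h11 q' \<in> orb q" using orb_eq[OF u(2)] by (auto simp: orb_def)
  show "tri (zt * x) \<in> expo_coset q"
    by (rule expo_cosetI[of "zt * u", OF _ u(2)]) (simp_all only: cnorm_mult cnorm_zt u mult.assoc mult_1)
  show "tri (g5 x) \<in> expo_coset q"
    by (rule expo_cosetI[of "g5 u", OF _ h(1)]) (simp_all only: u galois_mult galois_cnorm prod_pi_galois)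
  show "tri (g11 x) \<in> expo_coset q"
    by (rule expo_cosetI[of "g11 u", OF _ h(2)]) (simp_all only: u galois_mult galois_cnorm prod_pi_galois)
qed

text \<open>Leaders need not be unique; what matters later is that any choice has the least area and a
nonnegative orientation.\<close>
lemma is_leader_leader: "is_leader (expo_coset q) (leader (expo_coset q))"
proof -
  have "tri (prod_pi q) \<in> expo_coset q" by (rule prod_pi_mem_expo_coset)
  then obtain x where x: "tri x \<in> expo_coset q"
    and min: "\<And>y. tri y \<in> expo_coset q \<Longrightarrow> nat \<bar>darea x\<bar> \<le> nat \<bar>darea y\<bar>"
    using arg_min_nat_lemma[of "\<lambda>x. tri x \<in> expo_coset q" _ "\<lambda>x. nat \<bar>darea x\<bar>"] by blast
  obtain y where y: "tri y \<in> expo_coset q" "\<bar>darea y\<bar> = \<bar>darea x\<bar>" "leader_shape (tri y)"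
    using leader_shape_reachable[of "\<lambda>x. tri x \<in> expo_coset q" x] x expo_coset_closed by blast
  have "area (tri y) \<le> area S" if "S \<in> expo_coset q" for S
    using min[of "cyc_of S"] that y(2) area_tri[of y] area_tri[of "cyc_of S"] by simp
  then have "is_leader (expo_coset q) (tri y)" unfolding is_leader_def using y by blast
  then show ?thesis unfolding leader_def by (rule someI)
qed

lemma leader_form:
  obtains u q' where "cnorm u = 1" "q' \<in> orb q" "cyc_of (leader (expo_coset q)) = u * prod_pi q'"
  using is_leader_leader[of q] unfolding is_leader_def expo_coset_def by blast

lemma leader_darea_nonneg: "darea (cyc_of (leader (expo_coset q))) \<ge> 0"
  using is_leader_leader[of q] leader_shape_tri[of "cyc_of (leader (expo_coset q))"]
  unfolding is_leader_def by simp

lemma leader_darea_least: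
  "S \<in> expo_coset q \<Longrightarrow> darea (cyc_of (leader (expo_coset q))) \<le> \<bar>darea (cyc_of S)\<bar>"
  using is_leader_leader[of q] area_tri[of "cyc_of (leader (expo_coset q))"] area_tri[of "cyc_of S"]
    leader_darea_nonneg[of q] unfolding is_leader_def by force

lemma cnorm_leader: "cnorm (cyc_of (leader (expo_coset q))) = int p ^ exp_sum q"
proof -
  obtain u q' where "cnorm u = 1" "q' \<in> orb q" "cyc_of (leader (expo_coset q)) = u * prod_pi q'"
    using leader_form .
  then show ?thesis by (simp add: cnorm_mult cnorm_prod_pi exp_sum_orb)
qed

lemma real_norm_prod_pi: "real_norm (prod_pi (i, j, k, l)) = prod_pi (i + l, j + k, j + k, i + l)"
  unfolding real_norm_def prod_pi_galois h11.simps by (simp only: prod_pi.simps power_add mult_ac)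

lemma eis_norm_prod_pi: "eis_norm (prod_pi (i, j, k, l)) = prod_pi (i + k, j + l, i + k, j + l)"
  unfolding eis_norm_def prod_pi_galois h7.simps by (simp only: prod_pi.simps power_add mult_ac)

text \<open>Two cosets of the same class \<open>s\<close> contain elements with the same norm to \<open>\<int>[sqrt 3]\<close>: in the coset of
\<open>q\<close>, either \<open>q\<close> itself or \<open>h5 q\<close> has the two exponents in the order needed, and the unit can be copied. So every
area that occurs in one coset occurs in the other.\<close>
lemma leader_darea_le:
  assumes "sclass q = sclass q'" "exp_sum q = exp_sum q'"
  shows "darea (cyc_of (leader (expo_coset q))) \<le> darea (cyc_of (leader (expo_coset q')))"
proof -
  let ?L = "cyc_of (leader (expo_coset q'))"
  obtain u q1 where u: "cnorm u = 1" "q1 \<in> orb q'" "?L = u * prod_pi q1" using leader_form .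
  obtain i j k l where q: "q = (i, j, k, l)" by (metis prod_cases4)
  obtain i' j' k' l' where q1: "q1 = (i', j', k', l')" by (metis prod_cases4)
  have "min (i + l) (j + k) = min (i' + l') (j' + k')" "i + j + k + l = i' + j' + k' + l'"
    using assms class_orb(1)[OF u(2)] exp_sum_orb[OF u(2)] by (simp_all add: q q1)
  then have "(i + l = i' + l' \<and> j + k = j' + k') \<or> (j + k = i' + l' \<and> i + l = j' + k')"
    by (auto simp: min_def split: if_splits)
  then have "\<exists>q2\<in>{q, h5 q}. real_norm (prod_pi q2) = real_norm (prod_pi q1)"
    by (auto simp: q q1 real_norm_prod_pi add.commute simp del: prod_pi.simps)
  then obtain q2 where q2: "q2 \<in> orb q" "real_norm (prod_pi q2) = real_norm (prod_pi q1)"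
    unfolding orb_def by blast
  have "real_norm (u * prod_pi q2) = real_norm ?L" by (simp add: u real_norm_mult q2)
  then have "darea (u * prod_pi q2) = darea ?L" by (simp add: real_norm_eq_iff)
  moreover have "tri (u * prod_pi q2) \<in> expo_coset q" by (rule expo_cosetI[OF u(1) q2(1) refl])
  ultimately show ?thesis using leader_darea_least[of "tri (u * prod_pi q2)" q] leader_darea_nonneg[of q'] by simp
qed

lemma leader_real_norm_iff:
  assumes "exp_sum q = exp_sum q'"
  shows "real_norm (cyc_of (leader (expo_coset q))) = real_norm (cyc_of (leader (expo_coset q'))) \<longleftrightarrow> sclass q = sclass q'"
proof
  assume "sclass q = sclass q'"
  then have "darea (cyc_of (leader (expo_coset q))) = darea (cyc_of (leader (expo_coset q')))"
    using leader_darea_le[of q q'] leader_darea_le[of q' q] assms by simp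
  then show "real_norm (cyc_of (leader (expo_coset q))) = real_norm (cyc_of (leader (expo_coset q')))"
    using qform_unique[of "cyc_of (leader (expo_coset q))" "cyc_of (leader (expo_coset q'))"]
    by (simp add: real_norm_eq_iff cnorm_leader assms)
next
  assume eq: "real_norm (cyc_of (leader (expo_coset q))) = real_norm (cyc_of (leader (expo_coset q')))"
  obtain u q1 where u: "cnorm u = 1" "q1 \<in> orb q" "cyc_of (leader (expo_coset q)) = u * prod_pi q1" using leader_form .
  obtain v q2 where v: "cnorm v = 1" "q2 \<in> orb q'" "cyc_of (leader (expo_coset q')) = v * prod_pi q2" using leader_form .
  obtain i j k l where q1: "q1 = (i, j, k, l)" by (metis prod_cases4)
  obtain i' j' k' l' where q2: "q2 = (i', j', k', l')" by (metis prod_cases4)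
  have "real_norm u * prod_pi (i + l, j + k, j + k, i + l) = real_norm v * prod_pi (i' + l', j' + k', j' + k', i' + l')"
    using eq unfolding u v real_norm_mult q1 q2 real_norm_prod_pi .
  from exponents_unique[OF _ _ this] have "sclass q1 = sclass q2"
    by (simp add: q1 q2 cnorm_real_norm u v)
  then show "sclass q = sclass q'" using class_orb(1) u(2) v(2) by simp
qed

lemma labelled_same_area:
  assumes "exp_sum q = exp_sum q'" "sclass q = sclass q'"
  shows "area (labelled (expo_coset q) j h) = area (labelled (expo_coset q') j h)"
proof -
  obtain \<mu> where m: "label_unit j h \<mu>" using label_unit_exists by blast
  have "real_norm (\<mu> * cyc_of (leader (expo_coset q))) = real_norm (\<mu> * cyc_of (leader (expo_coset q')))"
    using leader_real_norm_iff[OF assms(1)] assms(2) by (simp add: real_norm_mult)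
  then show ?thesis using m by (simp add: label_unit_def area_tri real_norm_eq_iff)
qed

text \<open>A leader has nonnegative orientation, so its area determines its norm to \<open>\<int>[sqrt 3]\<close> without an
ambiguity of sign, and thereby the exponents of that norm.\<close>
lemma leader_area_sclass:
  assumes "exp_sum q = exp_sum q'"
    and "area (labelled (expo_coset q) 0 False) = area (labelled (expo_coset q') 0 False)"
  shows "sclass q = sclass q'"
proof -
  have "area (tri (cyc_of (leader (expo_coset q)))) = area (tri (cyc_of (leader (expo_coset q'))))"
    using assms(2) by (simp add: labelled_leader)
  then have "darea (cyc_of (leader (expo_coset q))) = darea (cyc_of (leader (expo_coset q')))"
    using leader_darea_nonneg[of q] leader_darea_nonneg[of q'] unfolding area_tri by simp
  then have "real_norm (cyc_of (leader (expo_coset q))) = real_norm (cyc_of (leader (expo_coset q')))"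
    using qform_unique[of "cyc_of (leader (expo_coset q))" "cyc_of (leader (expo_coset q'))"]
    by (simp add: real_norm_eq_iff cnorm_leader assms(1))
  then show ?thesis using leader_real_norm_iff[OF assms(1)] by blast
qed

text \<open>Both triangles have the same norm to \<open>\<int>[sqrt 3]\<close>, so congruence amounts to equality of the
Eisenstein norms up to units and conjugation, that is, to equality of the exponents up to order.\<close>
lemma labelled_congruent_iff:
  assumes "exp_sum q = exp_sum q'" "sclass q = sclass q'"
  shows "congruent (labelled (expo_coset q) j h) (labelled (expo_coset q') j h) \<longleftrightarrow> tclass q = tclass q'"
proof -
  obtain \<mu> where m: "cnorm \<mu> = 1" "\<And>C. labelled C j h = tri (\<mu> * cyc_of (leader C))"
    using label_unit_exists[of j h] unfolding label_unit_def by blast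
  define x where "x = \<mu> * cyc_of (leader (expo_coset q))"
  define y where "y = \<mu> * cyc_of (leader (expo_coset q'))"
  obtain u q1 where u: "cnorm u = 1" "q1 \<in> orb q" "cyc_of (leader (expo_coset q)) = u * prod_pi q1" using leader_form .
  obtain v q2 where v: "cnorm v = 1" "q2 \<in> orb q'" "cyc_of (leader (expo_coset q')) = v * prod_pi q2" using leader_form .
  have rn: "real_norm x = real_norm y"
    using leader_real_norm_iff[OF assms(1)] assms(2) by (simp add: x_def y_def real_norm_mult)
  have nx: "cnorm x = int p ^ exp_sum q" by (simp add: x_def cnorm_mult m cnorm_leader)
  have p0: "p > 0" using prime_gt_0_nat[OF prime_p] .
  have x0: "x \<noteq> 0" using nx p0 cnorm_0_iff[of x] by auto
  have n3: "\<not> 3 dvd qform x"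
  proof
    assume "3 dvd qform x"
    then have "3 dvd cnorm x" unfolding cnorm_def power2_eq_square by (intro dvd_diff dvd_mult2) simp_all
    then have "(3::int) dvd int p ^ exp_sum q" by (simp only: nx)
    then have "(3::int) dvd int p" by (rule prime_dvd_power[rotated]) simp
    then have "(3::int) = int p" using prime_int by (intro primes_dvd_imp_eq) simp_all
    then show False using p_neq by simp
  qed
  obtain i j k l where q1: "q1 = (i, j, k, l)" by (metis prod_cases4)
  obtain i' j' k' l' where q2: "q2 = (i', j', k', l')" by (metis prod_cases4)
  define a where "a = eis_norm (\<mu> * u)"
  define b where "b = eis_norm (\<mu> * v)"
  have ab: "cnorm a = 1" "cnorm b = 1" by (simp_all add: a_def b_def cnorm_eis_norm cnorm_mult m u v)
  have ex: "eis_norm x = a * prod_pi (i + k, j + l, i + k, j + l)"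
    unfolding x_def a_def u q1 eis_norm_mult eis_norm_prod_pi by (simp only: mult.assoc)
  have ey: "eis_norm y = b * prod_pi (i' + k', j' + l', i' + k', j' + l')"
    unfolding y_def b_def v q2 eis_norm_mult eis_norm_prod_pi by (simp only: mult.assoc)
  have gx: "g5 (eis_norm x) = g5 a * prod_pi (j + l, i + k, j + l, i + k)"
    unfolding ex galois_mult prod_pi_galois by simp
  have "congruent (tri x) (tri y) \<longleftrightarrow>
      (\<exists>w. cnorm w = 1 \<and> (eis_norm y = w * eis_norm x \<or> eis_norm y = w * g5 (eis_norm x)))"
    using rn x0 n3 unfolding real_norm_eq_iff by (intro congruent_iff_eis_norm) auto
  also have "\<dots> \<longleftrightarrow> (i' + k', j' + l') \<in> {(i + k, j + l), (j + l, i + k)}"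
  proof
    assume "\<exists>w. cnorm w = 1 \<and> (eis_norm y = w * eis_norm x \<or> eis_norm y = w * g5 (eis_norm x))"
    then obtain w where w: "cnorm w = 1" "eis_norm y = w * eis_norm x \<or> eis_norm y = w * g5 (eis_norm x)" by blast
    from w(2) show "(i' + k', j' + l') \<in> {(i + k, j + l), (j + l, i + k)}"
    proof
      assume "eis_norm y = w * eis_norm x"
      then have "b * prod_pi (i' + k', j' + l', i' + k', j' + l') = (w * a) * prod_pi (i + k, j + l, i + k, j + l)"
        unfolding ex ey by (simp only: mult.assoc)
      from exponents_unique[OF _ _ this] show ?thesis by (simp add: ab w cnorm_mult)
    next
      assume "eis_norm y = w * g5 (eis_norm x)"
      then have "b * prod_pi (i' + k', j' + l', i' + k', j' + l') = (w * g5 a) * prod_pi (j + l, i + k, j + l, i + k)"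
        unfolding gx ey by (simp only: mult.assoc)
      from exponents_unique[OF _ _ this] show ?thesis by (simp add: ab w cnorm_mult)
    qed
  next
    obtain a' where a': "cnorm a' = 1" "a * a' = 1" using unit_inverse[OF ab(1)] .
    have a'': "cnorm (g5 a') = 1" "g5 a * g5 a' = 1"
      using a' by (simp_all flip: galois_mult(1))
    have cancel: "b * c = (b * a') * (a * c)" "b * c = (b * g5 a') * (g5 a * c)" for c
      using arg_cong[OF a'(2), of "\<lambda>z. z * (b * c)"] arg_cong[OF a''(2), of "\<lambda>z. z * (b * c)"]
      by (simp_all add: mult_ac)
    assume "(i' + k', j' + l') \<in> {(i + k, j + l), (j + l, i + k)}"
    then consider "i' + k' = i + k" "j' + l' = j + l" | "i' + k' = j + l" "j' + l' = i + k" by auto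
    then show "\<exists>w. cnorm w = 1 \<and> (eis_norm y = w * eis_norm x \<or> eis_norm y = w * g5 (eis_norm x))"
    proof cases
      case 1
      have "eis_norm y = (b * a') * eis_norm x" unfolding ex ey 1 by (rule cancel(1))
      then show ?thesis using ab a' by (intro exI[of _ "b * a'"]) (simp add: cnorm_mult)
    next
      case 2
      have "eis_norm y = (b * g5 a') * g5 (eis_norm x)" unfolding gx ey 2 by (rule cancel(2))
      then show ?thesis using ab a'' by (intro exI[of _ "b * g5 a'"]) (simp add: cnorm_mult)
    qed
  qed
  also have "\<dots> \<longleftrightarrow> tclass q1 = tclass q2"
  proof -
    have "i + j + k + l = i' + j' + k' + l'"
      using assms(1) exp_sum_orb[OF u(2)] exp_sum_orb[OF v(2)] by (simp add: q1 q2)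
    then show ?thesis by (auto simp: q1 q2 min_def)
  qed
  also have "\<dots> \<longleftrightarrow> tclass q = tclass q'" using class_orb(2) u(2) v(2) by simp
  finally show ?thesis by (simp add: m x_def y_def)
qed

end

section \<open>Counting orbits\<close>

lemma card_image_cong_kernel:
  assumes "\<And>x y. x \<in> A \<Longrightarrow> y \<in> A \<Longrightarrow> f x = f y \<longleftrightarrow> g x = g y"
  shows "card (f ` A) = card (g ` A)"
proof -
  define h where "h C = g (inv_into A f C)" for C
  have h: "h (f x) = g x" if x: "x \<in> A" for x
    unfolding h_def using assms[OF inv_into_into[OF imageI[OF x]] x] f_inv_into_f[OF imageI[OF x], of f] by blast
  have "h ` f ` A = g ` A" unfolding image_image by (rule image_cong[OF refl h])
  moreover have "inj_on h (f ` A)"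
  proof (rule inj_onI)
    fix C D assume "C \<in> f ` A" "D \<in> f ` A" and eq: "h C = h D"
    then obtain x y where "C = f x" "x \<in> A" "D = f y" "y \<in> A" by blast
    then show "C = D" using eq assms[of x y] by (simp add: h)
  qed
  ultimately show ?thesis by (metis card_image)
qed

lemma card_exp_sum:
  "card {q. exp_sum q = n} = (n + 3) choose 3"
proof -
  let ?L = "{xs :: nat list. length xs = 4 \<and> sum_list xs = n}"
  let ?f = "\<lambda>(i, j, k, l). [i, j, k, l]"
  have "bij_betw ?f {q. exp_sum q = n} ?L"
    by (rule bij_betwI[of _ _ _ "\<lambda>xs. (xs ! 0, xs ! 1, xs ! 2, xs ! 3)"])
       (auto simp: numeral_eq_Suc length_Suc_conv)
  then have "card {q. exp_sum q = n} = card ?L" by (rule bij_betw_same_card)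
  also have "\<dots> = (n + 3) choose n" by (simp add: card_length_sum_list add.commute)
  also have "\<dots> = (n + 3) choose 3" using binomial_symmetric[of 3 "n + 3"] by simp
  finally show ?thesis .
qed

lemma finite_exp_sum: "finite {q. exp_sum q = n}"
proof (rule card_ge_0_finite)
  show "card {q. exp_sum q = n} > 0" unfolding card_exp_sum by (simp add: zero_less_binomial)
qed

definition stab :: "expo \<Rightarrow> nat" where
  "stab q = 1 + of_bool (h5 q = q) + of_bool (h7 q = q) + of_bool (h11 q = q)"

lemma h_eq_iff:
  "h5 q = h7 q \<longleftrightarrow> h11 q = q" "h7 q = h5 q \<longleftrightarrow> h11 q = q" "h5 q = h11 q \<longleftrightarrow> h7 q = q"
  "h11 q = h5 q \<longleftrightarrow> h7 q = q" "h7 q = h11 q \<longleftrightarrow> h5 q = q" "h11 q = h7 q \<longleftrightarrow> h5 q = q"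
  "q = h5 q \<longleftrightarrow> h5 q = q" "q = h7 q \<longleftrightarrow> h7 q = q" "q = h11 q \<longleftrightarrow> h11 q = q"
proof -
  obtain i j k l where q: "q = (i, j, k, l)" by (rule prod_cases4)
  show "h5 q = h7 q \<longleftrightarrow> h11 q = q" "h7 q = h5 q \<longleftrightarrow> h11 q = q" "h5 q = h11 q \<longleftrightarrow> h7 q = q"
    "h11 q = h5 q \<longleftrightarrow> h7 q = q" "h7 q = h11 q \<longleftrightarrow> h5 q = q" "h11 q = h7 q \<longleftrightarrow> h5 q = q"
    "q = h5 q \<longleftrightarrow> h5 q = q" "q = h7 q \<longleftrightarrow> h7 q = q" "q = h11 q \<longleftrightarrow> h11 q = q"
    unfolding q h5.simps h7.simps h11.simps prod.inject by blast+
qed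

text \<open>The orbit-stabilizer theorem for an action of the Klein four-group on the orbit of \<open>a\<close>: the assumptions
hold because each two of its involutions compose to the third.\<close>
lemma card_four_points:
  assumes "b = c \<longleftrightarrow> d = a" "b = d \<longleftrightarrow> c = a" "c = d \<longleftrightarrow> b = a"
  shows "card {a, b, c, d} * (1 + of_bool (b = a) + of_bool (c = a) + of_bool (d = a)) = 4"
proof (cases "b = a")
  case True
  then have "c = d" using assms(3) by blast
  with True show ?thesis by (cases "d = a") (simp_all add: card_insert_if)
next
  case b: False
  show ?thesis
  proof (cases "c = a")
    case True
    then have "b = d" using assms(2) by blast
    with True b show ?thesis by (simp add: card_insert_if)
  next
    case c: False
    show ?thesis
    proof (cases "d = a")
      case True
      then have "b = c" using assms(1) by blast
      with True b show ?thesis by (simp add: card_insert_if)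
    next
      case False
      then show ?thesis using assms b c by (simp add: card_insert_if)
    qed
  qed
qed

lemma orbit_stabilizer: "card (orb q) * stab q = 4"
  unfolding orb_def stab_def by (rule card_four_points) (rule h_eq_iff)+

lemma stab_orb: "q' \<in> orb q \<Longrightarrow> stab q' = stab q"
  unfolding orb_def by (elim insertE emptyE) (simp_all add: stab_def h_eq_iff)

text \<open>Each orbit contributes (orbit size) times (stabilizer size) = 4 to the sum.\<close>
lemma burnside: "4 * card (orb ` {q. exp_sum q = n}) = (\<Sum>q | exp_sum q = n. stab q)"
proof -
  have "(\<Sum>q | exp_sum q = n. stab q) = (\<Sum>X\<in>orb ` {q. exp_sum q = n}. \<Sum>q | q \<in> {q. exp_sum q = n} \<and> orb q = X. stab q)"
    by (rule sum.image_gen[OF finite_exp_sum])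
  also have "\<dots> = (\<Sum>X\<in>orb ` {q. exp_sum q = n}. 4)"
  proof (rule sum.cong[OF refl])
    fix X assume "X \<in> orb ` {q. exp_sum q = n}"
    then obtain q where q: "X = orb q" "exp_sum q = n" by blast
    have "{q'. q' \<in> {q. exp_sum q = n} \<and> orb q' = X} = orb q"
    proof (intro subset_antisym subsetI)
      fix q' assume "q' \<in> {q'. q' \<in> {q. exp_sum q = n} \<and> orb q' = X}"
      then show "q' \<in> orb q" using orb_refl[of q'] q(1) by simp
    next
      fix q' assume "q' \<in> orb q"
      from orb_eq[OF this] exp_sum_orb[OF this] q
      show "q' \<in> {q'. q' \<in> {q. exp_sum q = n} \<and> orb q' = X}" by simp
    qed
    moreover have "(\<Sum>q'\<in>orb q. stab q') = (\<Sum>q'\<in>orb q. stab q)" by (rule sum.cong) (simp_all add: stab_orb)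
    ultimately show "(\<Sum>q | q \<in> {q. exp_sum q = n} \<and> orb q = X. stab q) = 4"
      using orbit_stabilizer[of q] by simp
  qed
  finally show ?thesis by simp
qed

text \<open>Each of the three permutations is a product of two disjoint transpositions, so a fixed vector
consists of two pairs of equal entries.\<close>
lemma card_fixed:
  assumes h: "h \<in> {h5, h7, h11}"
  shows "card {q. exp_sum q = n \<and> h q = q} = (if even n then n div 2 + 1 else 0)"
proof -
  define f :: "nat \<Rightarrow> nat \<Rightarrow> expo" where
    "f i j = (if h = h5 then (i, i, j, j) else if h = h7 then (i, j, i, j) else (i, j, j, i))" for i j
  have h: "h = h5 \<or> h = h7 \<or> h = h11" using h by simp
  have ne: "h5 \<noteq> h7" "h5 \<noteq> h11" "h7 \<noteq> h11"
    by (rule notI, drule fun_cong[of _ _ "(0, 1, 2, 3)"], simp)+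
  have sum: "exp_sum (f i j) = 2 * (i + j)" for i j by (simp add: f_def)
  have inj: "f i j = f i' j' \<Longrightarrow> i = i'" for i j i' j' by (simp add: f_def split: if_splits)
  have fixed: "h q = q \<longleftrightarrow> (\<exists>i j. q = f i j)" for q
  proof -
    obtain a b c d where q: "q = (a, b, c, d)" by (rule prod_cases4)
    from h show ?thesis
      by (elim disjE) (use ne in \<open>auto simp: q f_def\<close>)
  qed
  show ?thesis
  proof (cases "even n")
    case False
    have "\<not> (exp_sum q = n \<and> h q = q)" for q
    proof
      assume q: "exp_sum q = n \<and> h q = q"
      then obtain i j where "q = f i j" using fixed by blast
      then have "n = exp_sum (f i j)" using q by simp
      then show False using False unfolding sum by simp
    qed
    then have empty: "{q. exp_sum q = n \<and> h q = q} = {}" by blast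
    show ?thesis unfolding empty using False by simp
  next
    case True
    then obtain m where m: "n = 2 * m" by blast
    have "{q. exp_sum q = n \<and> h q = q} = (\<lambda>i. f i (m - i)) ` {..m}"
    proof (intro subset_antisym subsetI)
      fix q assume "q \<in> {q. exp_sum q = n \<and> h q = q}"
      then obtain i j where ij: "q = f i j" "exp_sum q = n" using fixed by blast
      then have "i + j = m" using sum m by simp
      then show "q \<in> (\<lambda>i. f i (m - i)) ` {..m}" using ij(1) by (intro image_eqI[of _ _ i]) auto
    next
      fix q assume "q \<in> (\<lambda>i. f i (m - i)) ` {..m}"
      then obtain i where i: "q = f i (m - i)" "i \<le> m" by blast
      have "h q = q" using fixed i(1) by blast
      moreover have "exp_sum q = n" using i m by (simp add: sum)
      ultimately show "q \<in> {q. exp_sum q = n \<and> h q = q}" by simp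
    qed
    moreover have "inj_on (\<lambda>i. f i (m - i)) {..m}" using inj by (rule inj_onI)
    ultimately show ?thesis using m by (simp add: card_image)
  qed
qed

lemma card_orbits:
  "real (card (orb ` {q. exp_sum q = n})) =
     (real n + 2) * (2 * (real n)\<^sup>2 + 8 * real n + 15 + 9 * (-1) ^ n) / 48"
proof -
  let ?F = "if even n then n div 2 + 1 else 0"
  have "(\<Sum>q | exp_sum q = n. stab q) = card {q. exp_sum q = n} +
     card {q. exp_sum q = n \<and> h5 q = q} + card {q. exp_sum q = n \<and> h7 q = q} + card {q. exp_sum q = n \<and> h11 q = q}"
  proof -
    have of_bool: "(\<Sum>q | exp_sum q = n. of_bool (P q)) = card {q. exp_sum q = n \<and> P q}" for P
      using finite_exp_sum[of n] by (simp add: sum_of_bool_eq Collect_conj_eq)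
    show ?thesis unfolding stab_def sum.distrib of_bool by simp
  qed
  then have "4 * card (orb ` {q. exp_sum q = n}) = ((n + 3) choose 3) + 3 * ?F"
    unfolding burnside by (simp add: card_exp_sum card_fixed)
  moreover have "6 * ((n + 3) choose 3) = (n + 3) * (n + 2) * (n + 1)"
  proof -
    have three: "3 * ((n + 3) choose 3) = (n + 3) * ((n + 2) choose 2)"
      using Suc_times_binomial[of 2 "n + 2"] by (simp add: numeral_eq_Suc)
    have two: "2 * ((n + 2) choose 2) = (n + 2) * (n + 1)"
      using Suc_times_binomial[of 1 "n + 1"] by (simp add: numeral_eq_Suc)
    have "6 * ((n + 3) choose 3) = 2 * (3 * ((n + 3) choose 3))" by simp
    also have "\<dots> = (n + 3) * (2 * ((n + 2) choose 2))" by (simp only: three mult.left_commute)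
    also have "\<dots> = (n + 3) * (n + 2) * (n + 1)" by (simp only: two mult.assoc)
    finally show ?thesis .
  qed
  moreover define c where "c = card (orb ` {q. exp_sum q = n})"
  moreover define f where "f = ?F"
  ultimately have "24 * c = (n + 3) * (n + 2) * (n + 1) + 18 * f" by linarith
  then have "real (24 * c) = real ((n + 3) * (n + 2) * (n + 1) + 18 * f)" by (simp only:)
  then have "24 * real c = (real n + 3) * (real n + 2) * (real n + 1) + 18 * real f"
    by (simp only: of_nat_mult of_nat_add of_nat_numeral of_nat_1)
  moreover have "18 * real f = 9 * (real n + 2) * (1 + (-1) ^ n) / 2"
  proof (cases "even n")
    case True
    then obtain m where "n = 2 * m" by blast
    then show ?thesis by (simp add: f_def)
  qed (simp add: f_def)
  ultimately have "48 * real c = (real n + 2) * (2 * (real n)\<^sup>2 + 8 * real n + 15 + 9 * (-1) ^ n)"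
    by (simp add: power2_eq_square algebra_simps)
  then show ?thesis unfolding c_def by simp
qed

section \<open>The families\<close>

text \<open>If \<open>s = 0\<close>, only two exponents, which are exchanged by \<open>h11\<close>, can be nonzero, and \<open>t\<close> is the smaller
of them. So \<open>t\<close> and the sum determine the orbit.\<close>
lemma same_orbit_if_sclass_zero:
  assumes "exp_sum q = exp_sum q'" "sclass q = 0" "sclass q' = 0" "tclass q = tclass q'"
  shows "q' \<in> orb q"
proof -
  obtain i j k l where q: "q = (i, j, k, l)" by (metis prod_cases4)
  obtain i' j' k' l' where q': "q' = (i', j', k', l')" by (metis prod_cases4)
  have "(i = 0 \<and> l = 0) \<or> (j = 0 \<and> k = 0)" "(i' = 0 \<and> l' = 0) \<or> (j' = 0 \<and> k' = 0)"
    using assms(2,3) by (auto simp: q q' min_def split: if_splits)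
  then show ?thesis using assms(1,4)
    by (elim disjE conjE) (auto simp: q q' orb_def min_def split: if_splits)
qed

text \<open>Within class \<open>s\<close> an orbit is roughly a pair \<open>(i, k)\<close> and \<open>t\<close> records \<open>i + k\<close>, which \<open>(0, 1)\<close> and
\<open>(1, 0)\<close> share. If \<open>2 s = n\<close>, then \<open>h7\<close> preserves the class and identifies these two, but \<open>(0, 2)\<close> and \<open>(1, 1)\<close> are
still in different orbits, and \<open>n > 2\<close> leaves room for them.\<close>
lemma congruent_pair_exists:
  assumes "n > 2" "0 < s" "s \<le> n div 2"
  shows "\<exists>q q'. exp_sum q = n \<and> exp_sum q' = n \<and> sclass q = s \<and> sclass q' = s \<and> tclass q = tclass q' \<and> orb q \<noteq> orb q'"
proof (cases "2 * s = n")
  case True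
  define q q' where "q = (0::nat, s - 2, 2::nat, s)" and "q' = (1::nat, s - 1, 1::nat, s - 1)"
  have "q \<notin> orb q'" using assms True by (auto simp: q_def q'_def orb_def)
  then show ?thesis using assms True orb_refl[of q]
    by (intro exI[of _ q] exI[of _ q']) (auto simp: q_def q'_def)
next
  case False
  define q q' where "q = (0::nat, n - s - 1, 1::nat, s)" and "q' = (1::nat, n - s, 0::nat, s - 1)"
  have "q \<notin> orb q'" using assms False by (auto simp: q_def q'_def orb_def)
  then show ?thesis using assms False orb_refl[of q]
    by (intro exI[of _ q] exI[of _ q']) (auto simp: q_def q'_def)
qed

lemma noncongruent_pair_exists:
  assumes "n > 2" "0 < s" "s \<le> n div 2"
  shows "\<exists>q q'. exp_sum q = n \<and> exp_sum q' = n \<and> sclass q = s \<and> sclass q' = s \<and> tclass q \<noteq> tclass q'"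
  using assms
  by (intro exI[of _ "(0::nat, n - s, 0::nat, s)"] exI[of _ "(1::nat, n - s, 0::nat, s - 1)"]) auto

context split_prime
begin

definition family :: "nat \<Rightarrow> nat \<Rightarrow> triangle set set" where
  "family n s = expo_coset ` {q. exp_sum q = n \<and> sclass q = s}"

lemma familyE:
  assumes "C \<in> family n s"
  obtains q where "C = expo_coset q" "exp_sum q = n" "sclass q = s"
  using assms unfolding family_def by blast

lemma family_nonempty: "s \<le> n div 2 \<Longrightarrow> expo_coset (0, n - s, 0, s) \<in> family n s"
  unfolding family_def by (intro imageI) auto

lemma family_subset: "family n s \<subseteq> solution_cosets (p ^ n)"
  unfolding family_def solution_cosets_eq by auto

lemma family_sclass:
  assumes "expo_coset q \<in> family n s"
  shows "sclass q = s"
proof -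
  obtain q' where "expo_coset q = expo_coset q'" "sclass q' = s" using familyE[OF assms] .
  then have "sclass q' = s" "orb q = orb q'" by (simp_all only: expo_coset_eq_iff)
  then show ?thesis using class_orb(1)[of q q'] orb_refl[of q] by simp
qed

lemma families_partition:
  "partition_on (solution_cosets (p ^ n)) (family n ` {..n div 2})" "card (family n ` {..n div 2}) = n div 2 + 1"
proof -
  have sep: "s = s'" if C: "C \<in> family n s" "C \<in> family n s'" for C s s'
  proof -
    obtain q where q: "C = expo_coset q" "exp_sum q = n" "sclass q = s" using familyE[OF C(1)] .
    then show ?thesis using family_sclass[of q n s'] C(2) by simp
  qed
  have bound: "sclass q \<le> n div 2" if sum: "exp_sum q = n" for q
  proof -
    obtain i j k l where q: "q = (i, j, k, l)" by (rule prod_cases4)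
    have "2 * min (i + l) (j + k) \<le> (i + l) + (j + k)" by (simp add: min_def)
    then show ?thesis using sum by (simp add: q)
  qed
  have "inj_on (family n) {..n div 2}"
  proof (rule inj_onI)
    fix s s' assume "s \<in> {..n div 2}" "family n s = family n s'"
    then show "s = s'" using sep[of "expo_coset (0, n - s, 0, s)" s s'] family_nonempty[of s n] by simp
  qed
  then show "card (family n ` {..n div 2}) = n div 2 + 1" by (simp add: card_image)
  show "partition_on (solution_cosets (p ^ n)) (family n ` {..n div 2})"
  proof (rule partition_onI)
    show "\<Union> (family n ` {..n div 2}) = solution_cosets (p ^ n)"
    proof (intro subset_antisym subsetI)
      fix C assume "C \<in> \<Union> (family n ` {..n div 2})"
      then show "C \<in> solution_cosets (p ^ n)" using family_subset by blast
    next
      fix C assume "C \<in> solution_cosets (p ^ n)"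
      then obtain q where "C = expo_coset q" "exp_sum q = n" unfolding solution_cosets_eq by blast
      then show "C \<in> \<Union> (family n ` {..n div 2})"
        using bound[of q] unfolding family_def by blast
    qed
    show "disjnt F G" if FG: "F \<in> family n ` {..n div 2}" "G \<in> family n ` {..n div 2}" "F \<noteq> G" for F G
      using FG sep unfolding disjnt_iff by blast
    show "{} \<notin> family n ` {..n div 2}"
      using family_nonempty by blast
  qed
qed

lemma family_same_areas: "same_areas (family n s) j h"
  unfolding same_areas_def
proof (intro ballI)
  fix C D assume CD: "C \<in> family n s" "D \<in> family n s"
  obtain q where q: "C = expo_coset q" "exp_sum q = n" "sclass q = s" using familyE[OF CD(1)] .
  obtain q' where q': "D = expo_coset q'" "exp_sum q' = n" "sclass q' = s" using familyE[OF CD(2)] .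
  show "area (labelled C j h) = area (labelled D j h)"
    unfolding q(1) q'(1) by (rule labelled_same_area) (simp_all only: q q')
qed

text \<open>A coset outside the family has another class \<open>s\<close>, hence a leader of different area, so no larger
set of cosets has equal areas even at label 0.\<close>
lemma family_maximal:
  assumes "s \<le> n div 2" "P (family n s)" "\<And>G. P G \<Longrightarrow> same_areas G 0 False"
  shows "maximal_family (p ^ n) P (family n s)"
  unfolding maximal_family_def
proof (intro conjI allI impI notI family_subset assms(2))
  fix G assume G: "family n s \<subset> G \<and> G \<subseteq> solution_cosets (p ^ n)" "P G"
  then obtain C where C: "C \<in> G" "C \<notin> family n s" by blast
  then obtain q where q: "C = expo_coset q" "exp_sum q = n" using G(1) unfolding solution_cosets_eq by blast
  let ?q = "(0, n - s, 0, s)"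
  have sum: "exp_sum ?q = n" "sclass ?q = s" using assms(1) by auto
  have "expo_coset ?q \<in> G" using family_nonempty[OF assms(1)] G(1) by blast
  then have "area (labelled (expo_coset q) 0 False) = area (labelled (expo_coset ?q) 0 False)"
    using assms(3)[OF G(2)] C(1) unfolding same_areas_def q(1) by blast
  then have "sclass q = s" using leader_area_sclass[of q ?q] q(2) sum by simp
  then show False using C(2) q unfolding family_def by blast
qed

lemma family_B1: "class_B1 (p ^ n) (family n 0)"
  unfolding class_B1_def
proof (rule family_maximal)
  show "B1_property (family n 0)"
    unfolding B1_property_def
  proof (intro allI conjI family_same_areas ballI impI notI)
    fix j h C D
    assume CD: "C \<in> family n 0" "D \<in> family n 0" "C \<noteq> D" and c: "congruent (labelled C j h) (labelled D j h)"
    obtain q where q: "C = expo_coset q" "exp_sum q = n" "sclass q = 0" using familyE[OF CD(1)] .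
    obtain q' where q': "D = expo_coset q'" "exp_sum q' = n" "sclass q' = 0" using familyE[OF CD(2)] .
    have "tclass q = tclass q'"
      using c labelled_congruent_iff[of q q' j h] unfolding q(1) q'(1) q(2,3) q'(2,3) by blast
    then have "q' \<in> orb q" by (intro same_orbit_if_sclass_zero) (simp_all only: q q')
    then have "orb q = orb q'" using orb_eq by blast
    then show False using CD(3) unfolding q(1) q'(1) expo_coset_eq_iff by blast
  qed
qed (simp_all add: B1_property_def)

lemma family_B2:
  assumes "n > 2" "0 < s" "s \<le> n div 2"
  shows "class_B2 (p ^ n) (family n s)"
  unfolding class_B2_def
proof (rule family_maximal[OF assms(3)])
  show "B2_property (family n s)"
    unfolding B2_property_def
  proof (intro allI conjI family_same_areas)
    fix j h
    obtain q q' where q: "exp_sum q = n" "exp_sum q' = n" "sclass q = s" "sclass q' = s" "tclass q = tclass q'" "orb q \<noteq> orb q'"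
      using congruent_pair_exists[OF assms] by blast
    then have mem: "expo_coset q \<in> family n s" "expo_coset q' \<in> family n s" unfolding family_def by blast+
    have "congruent (labelled (expo_coset q) j h) (labelled (expo_coset q') j h)"
      using labelled_congruent_iff[of q q' j h] q by (simp only:)
    moreover have "expo_coset q \<noteq> expo_coset q'" using q(6) unfolding expo_coset_eq_iff .
    ultimately show "\<exists>C\<in>family n s. \<exists>D\<in>family n s. C \<noteq> D \<and> congruent (labelled C j h) (labelled D j h)"
      using mem by (intro bexI[of _ "expo_coset q"] bexI[of _ "expo_coset q'"] conjI)
  next
    fix j h
    obtain q q' where q: "exp_sum q = n" "exp_sum q' = n" "sclass q = s" "sclass q' = s" "tclass q \<noteq> tclass q'"
      using noncongruent_pair_exists[OF assms] by blast
    then have "expo_coset q \<in> family n s" "expo_coset q' \<in> family n s" unfolding family_def by blast+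
    moreover have "\<not> congruent (labelled (expo_coset q) j h) (labelled (expo_coset q') j h)"
      using labelled_congruent_iff[of q q' j h] q by simp
    ultimately show "\<exists>C\<in>family n s. \<exists>D\<in>family n s. \<not> congruent (labelled C j h) (labelled D j h)" by blast
  qed
qed (simp add: B2_property_def)

lemma card_solution_cosets:
  "real (card (solution_cosets (p ^ n))) =
     (real n + 2) * (2 * (real n)\<^sup>2 + 8 * real n + 15 + 9 * (-1) ^ n) / 48"
  unfolding solution_cosets_eq card_orbits[symmetric]
  by (simp only: card_image_cong_kernel[of "{q. exp_sum q = n}" expo_coset orb] expo_coset_eq_iff)

end

theorem theorem10:
  fixes p \<rho> r :: nat
  assumes "prime p" and "p mod 12 = 1" and "\<rho> > 2" and "r = p ^ \<rho>"
  shows "real (card (solution_cosets r)) =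
           (real \<rho> + 2) * (2 * (real \<rho>)\<^sup>2 + 8 * real \<rho> + 15 + 9 * (-1) ^ \<rho>) / 48 \<and>
         (\<exists>\<F>. partition_on (solution_cosets r) \<F> \<and>
              card \<F> = \<rho> div 2 + 1 \<and>
              (\<exists>F\<in>\<F>. class_B1 r F \<and> (\<forall>G\<in>\<F> - {F}. class_B2 r G)))"
proof -
  obtain c \<pi> where "split_prime p c \<pi>" using split_prime_exists[OF assms(1,2)] by blast
  then interpret split_prime p c \<pi> .
  let ?\<F> = "family \<rho> ` {..\<rho> div 2}"
  have "class_B2 r G" if G: "G \<in> ?\<F> - {family \<rho> 0}" for G
  proof -
    obtain s where "G = family \<rho> s" "s \<le> \<rho> div 2" using G by blast
    moreover have "s > 0" using G \<open>G = family \<rho> s\<close> by (intro gr0I) simp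
    ultimately show ?thesis unfolding assms(4) using family_B2[OF assms(3)] by simp
  qed
  moreover have "class_B1 r (family \<rho> 0)" unfolding assms(4) by (rule family_B1)
  ultimately have classes: "\<exists>F\<in>?\<F>. class_B1 r F \<and> (\<forall>G\<in>?\<F> - {F}. class_B2 r G)"
    by (intro bexI[of _ "family \<rho> 0"]) auto
  show ?thesis
    unfolding assms(4)
    by (intro conjI card_solution_cosets exI[of _ ?\<F>] families_partition classes[unfolded assms(4)])
qed

end
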